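(* Let Assumptions 1, 2 and 3 (recalled in the context) hold, and let $(x^k)_k$ be generated by the Stochastic Frank-Wolfe algorithm described in the context, with numbers of samples $(n_k)_k$. Put $\gamma_K=J(x^K)-\mathcal{J}^*$. Then, for all $K=1,\dots,2N$, $$\mathbb{E}[\gamma_K]\le\frac{4C_1}{K}.$$ Moreover, for all $\epsilon>0$, $$\mathbb{P}\Big[\gamma_K<\frac{4C_1}{K}+\epsilon\Big]\ge1-\exp\left(\frac{-\epsilon^2N}{2(v_K+\epsilon m_K/3)}\right),$$ where $$v_K=\frac{2C_0^2}{K^2(K+1)^2}\left(\sum_{k=1}^{K-1}\frac{k(k+1)^2}{n_k}\right),\qquad m_K=\frac{C_0}{K(K+1)}\left(\max_{k=1,\dots,K-1}\frac{(k+1)(k+2)}{n_k}\right).$$ Finally, $$\mathrm{Var}[\gamma_K]\le\frac{16C_1^2}{K^2}+\frac{v_K}{N}\qquad\text{and}\qquad\mathbb{E}\Big[\Big(\max\Big(\gamma_K-\frac{4C_1}{K},0\Big)\Big)^2\Big]\le\frac{v_K}{N}.$$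
   Context: Setting. $N,M\ge1$ are integers; $\mathcal{X}_1,\dots,\mathcal{X}_N$ are nonempty sets and $\mathcal{X}=\prod_{i=1}^N\mathcal{X}_i$; $\mathcal{E}_1,\dots,\mathcal{E}_M$ are separable real Hilbert spaces and $\mathcal{E}=\prod_{j=1}^M\mathcal{E}_j$ with scalar product $\langle y,y'\rangle=\sum_j\langle y_j,y_j'\rangle_{\mathcal{E}_j}$. For each $i,j$ we are given maps $g_{ij}:\mathcal{X}_i\to\mathcal{E}_j$ and $f_j:\mathcal{E}_j\to\mathbb{R}$; $g_i=(g_{ij})_{j=1,\dots,M}$, $f(y)=\sum_{j=1}^M f_j(y_j)$, $G(x)=\frac1N\sum_{i=1}^Ng_i(x_i)$, $J(x)=f(G(x))$ for $x\in\mathcal{X}$. Randomized problem. $\mathcal{P}_\delta(\mathcal{X}_i)$ is the set of finitely supported probability measures on $\mathcal{X}_i$, $\mathcal{P}_\delta=\prod_i\mathcal{P}_\delta(\mathcal{X}_i)$, $E_{\mu_i}[g_i]$ is the integral of $g_i$ with respect to $\mu_i$, $\mathcal{J}(\mu)=f\big(\frac1N\sum_{i=1}^NE_{\mu_i}[g_i]\big)$, and $\mathcal{J}^*=\inf_{\mu\in\mathcal{P}_\delta}\mathcal{J}(\mu)$. Assumption 1. Let $S_{ij}=g_{ij}(\mathcal{X}_i)$ and $S_j=\frac1N\sum_{i=1}^NS_{ij}$ (Minkowski sum). For all $i,j$: (1) $S_{ij}$ has finite diameter $d_{ij}$; (2) $f_j$ is $L_j$-Lipschitz on $\mathrm{conv}(S_j)$;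 (3) $f_j$ is continuously differentiable on a neighborhood of $\mathrm{conv}(S_j)$ and $\nabla f_j$ is $\tilde L_j$-Lipschitz on $\mathrm{conv}(S_j)$. Assumption 2. For all $j$, $f_j$ is convex over $\mathrm{conv}(S_j)$. Assumption 3. Let $\mathcal{A}=\{\nabla f(y)\mid y\in\mathrm{conv}(G(\mathcal{X}))\}\subset\mathcal{E}$. For all $i$ and all $\lambda\in\mathcal{A}$, the problem $\inf_{x_i\in\mathcal{X}_i}\langle\lambda,g_i(x_i)\rangle$ has at least one solution; a map $\mathbb{S}_i:\mathcal{A}\to\mathcal{X}_i$ is fixed such that $\mathbb{S}_i(\lambda)$ is a solution of it for every $\lambda\in\mathcal{A}$. Constants (taken positive): $C_0=\sum_{j=1}^M\big(L_j\max_{1\le i\le N}d_{ij}\big)>0$ and $C_1=\frac1N\sum_{j=1}^M\big(\tilde L_j\sum_{i=1}^Nd_{ij}^2\big)>0$. Stochastic Frank-Wolfe algorithm. Let $x^0\in\mathcal{X}$ and let $(n_k)_{k\ge0}$ be a (deterministic) sequence of positive integers. For $k=0,1,2,\dots$: set $y^k=\frac1N\sum_{i=1}^Ng_i(x_i^k)$, $\lambda^k=\nabla f(y^k)$, $\bar x_i^k=\mathbb{S}_i(\lambda^k)$ for $i=1,\dots,N$, and $\omega_k=\frac{2}{k+2}$. For $j=1,\dots,n_k$ and $i=1,\dots,N$, draw a Bernoulli random variable $P_i^{k,j}$ with parameter $\omega_k$, all these variables (over all $k,j,i$) being independent, and let $\hat x_i^{k,j}=x_i^k$ if $P_i^{k,j}=0$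 and $\hat x_i^{k,j}=\bar x_i^k$ if $P_i^{k,j}=1$; put $\hat x^{k,j}=(\hat x_i^{k,j})_{i=1,\dots,N}$. Let $x^{k+1}$ be a minimizer of $J$ over the finite set $\{\hat x^{k,j}\mid j=1,\dots,n_k\}$ (ties being broken by a deterministic rule depending only on the variables drawn so far, so that $x^{k+1}$ is a function of the $P_i^{k',j}$ with $k'\le k$). Convention: for $K=1$ the sum and the maximum over the empty range $k=1,\dots,K-1$ are $0$, so $v_1=m_1=0$, and the exponential term is then read as $0$. *)

theory Defs
  imports "HOL-Probability.Probability"
begin

text \<open>
  Conventions. The agents are indexed by a finite type \<open>'n\<close> (\<open>N = CARD('n)\<close>), the blocks by a finite
  type \<open>'m\<close> (\<open>M = CARD('m)\<close>). The sets \<open>X i\<close> live in a common type \<open>'x\<close>. The separable Hilbert spaces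
  \<open>E j\<close> are closed subspaces of an ambient separable Hilbert space \<open>'e\<close>, which may for instance be
  their direct sum; they may thus differ from each other. An element of the product of the \<open>E j\<close> is a
  vector in \<open>'e ^ 'm\<close>, whose inner product is the sum of the inner products of the components.
  The values of \<open>f j\<close> outside \<open>E j\<close> and of \<open>g i j\<close> outside \<open>X i\<close> play no role.
\<close>

definition dec_space :: "('n \<Rightarrow> 'x set) \<Rightarrow> ('n \<Rightarrow> 'x) set" where
  "dec_space X = {x. \<forall>i. x i \<in> X i}"

definition obs_space :: "('m::finite \<Rightarrow> 'e set) \<Rightarrow> ('e ^ 'm) set" where
  "obs_space E = {y. \<forall>j. y $ j \<in> E j}"

definition contrib :: "('n \<Rightarrow> 'm \<Rightarrow> 'x \<Rightarrow> 'e) \<Rightarrow> 'n \<Rightarrow> 'x \<Rightarrow> 'e ^ 'm::finite" where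
  "contrib g i x = (\<chi> j. g i j x)"

definition agg ::
    "('n::finite \<Rightarrow> 'm::finite \<Rightarrow> 'x \<Rightarrow> 'e::real_vector) \<Rightarrow> ('n \<Rightarrow> 'x) \<Rightarrow> 'e ^ 'm" where
  "agg g x = (1 / real CARD('n)) *\<^sub>R (\<Sum>i\<in>UNIV. contrib g i (x i))"

definition social :: "('m::finite \<Rightarrow> 'e \<Rightarrow> real) \<Rightarrow> 'e ^ 'm \<Rightarrow> real" where
  "social f y = (\<Sum>j\<in>UNIV. f j (y $ j))"

definition cost ::
    "('m::finite \<Rightarrow> 'e::real_vector \<Rightarrow> real) \<Rightarrow> ('n::finite \<Rightarrow> 'm \<Rightarrow> 'x \<Rightarrow> 'e) \<Rightarrow> ('n \<Rightarrow> 'x) \<Rightarrow> real" where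
  "cost f g x = social f (agg g x)"


subsection \<open>The randomized problem\<close>

definition fin_supp_measures :: "('n \<Rightarrow> 'x set) \<Rightarrow> ('n \<Rightarrow> 'x pmf) set" where
  "fin_supp_measures X = {\<mu>. \<forall>i. finite (set_pmf (\<mu> i)) \<and> set_pmf (\<mu> i) \<subseteq> X i}"

definition mean_contrib ::
    "('n \<Rightarrow> 'm::finite \<Rightarrow> 'x \<Rightarrow> 'e::{real_inner, banach, second_countable_topology})
      \<Rightarrow> 'n \<Rightarrow> 'x pmf \<Rightarrow> 'e ^ 'm" where
  "mean_contrib g i p = (\<chi> j. measure_pmf.expectation p (g i j))"

definition rcost ::
    "('m::finite \<Rightarrow> 'e \<Rightarrow> real)
      \<Rightarrow> ('n::finite \<Rightarrow> 'm \<Rightarrow> 'x \<Rightarrow> 'e::{real_inner, banach, second_countable_topology})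
      \<Rightarrow> ('n \<Rightarrow> 'x pmf) \<Rightarrow> real" where
  "rcost f g \<mu> = social f ((1 / real CARD('n)) *\<^sub>R (\<Sum>i\<in>UNIV. mean_contrib g i (\<mu> i)))"

definition rcost_inf ::
    "('n::finite \<Rightarrow> 'x set) \<Rightarrow> ('m::finite \<Rightarrow> 'e \<Rightarrow> real)
      \<Rightarrow> ('n \<Rightarrow> 'm \<Rightarrow> 'x \<Rightarrow> 'e::{real_inner, banach, second_countable_topology}) \<Rightarrow> real" where
  "rcost_inf X f g = (INF \<mu>\<in>fin_supp_measures X. rcost f g \<mu>)"

definition gap ::
    "('n::finite \<Rightarrow> 'x set) \<Rightarrow> ('m::finite \<Rightarrow> 'e \<Rightarrow> real)
      \<Rightarrow> ('n \<Rightarrow> 'm \<Rightarrow> 'x \<Rightarrow> 'e::{real_inner, banach, second_countable_topology})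
      \<Rightarrow> ('n \<Rightarrow> 'x) \<Rightarrow> real" where
  "gap X f g x = cost f g x - rcost_inf X f g"


subsection \<open>Gradients relative to a subspace\<close>

text \<open>
  For \<open>V = UNIV\<close> this is \<open>GDERIV\<close>. On a subspace \<open>V\<close> containing \<open>y\<close>, the requirement \<open>v \<in> V\<close> makes
  the gradient unique.
\<close>

definition has_gradient :: "'a::real_inner set \<Rightarrow> ('a \<Rightarrow> real) \<Rightarrow> 'a \<Rightarrow> 'a \<Rightarrow> bool" where
  "has_gradient V F v y \<longleftrightarrow> v \<in> V \<and> (F has_derivative (\<lambda>h. v \<bullet> h)) (at y within V)"

definition gradient :: "'a::real_inner set \<Rightarrow> ('a \<Rightarrow> real) \<Rightarrow> 'a \<Rightarrow> 'a" where
  "gradient V F y = (THE v. has_gradient V F v y)"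

text \<open>
  Continuous differentiability on a neighbourhood, relative to \<open>V\<close>, of a set \<open>C\<close>.
\<close>

definition C1_near :: "'a::real_inner set \<Rightarrow> ('a \<Rightarrow> real) \<Rightarrow> 'a set \<Rightarrow> bool" where
  "C1_near V F C \<longleftrightarrow>
     (\<exists>U. openin (top_of_set V) U \<and> C \<subseteq> U \<and>
          (\<forall>y\<in>U. \<exists>v. has_gradient V F v y) \<and> continuous_on U (gradient V F))"


subsection \<open>Assumptions and constants\<close>

definition range_ij :: "('n \<Rightarrow> 'x set) \<Rightarrow> ('n \<Rightarrow> 'm \<Rightarrow> 'x \<Rightarrow> 'e) \<Rightarrow> 'n \<Rightarrow> 'm \<Rightarrow> 'e set" where
  "range_ij X g i j = g i j ` X i"

text \<open>The sum below is the Minkowski sum of sets from \<open>HOL-Library.Set_Algebras\<close>.\<close>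

definition range_j ::
    "('n::finite \<Rightarrow> 'x set) \<Rightarrow> ('n \<Rightarrow> 'm \<Rightarrow> 'x \<Rightarrow> 'e::real_vector) \<Rightarrow> 'm \<Rightarrow> 'e set" where
  "range_j X g j = (\<lambda>s. (1 / real CARD('n)) *\<^sub>R s) ` (\<Sum>i\<in>UNIV. range_ij X g i j)"

definition diam ::
    "('n \<Rightarrow> 'x set) \<Rightarrow> ('n \<Rightarrow> 'm \<Rightarrow> 'x \<Rightarrow> 'e::metric_space) \<Rightarrow> 'n \<Rightarrow> 'm \<Rightarrow> real" where
  "diam X g i j = diameter (range_ij X g i j)"

definition problem_data ::
    "('n \<Rightarrow> 'x set) \<Rightarrow> ('m \<Rightarrow> 'e::real_normed_vector set) \<Rightarrow> ('n \<Rightarrow> 'm \<Rightarrow> 'x \<Rightarrow> 'e) \<Rightarrow> bool" where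
  "problem_data X E g \<longleftrightarrow>
     (\<forall>i. X i \<noteq> {}) \<and> (\<forall>j. subspace (E j) \<and> closed (E j)) \<and> (\<forall>i j. g i j \<in> X i \<rightarrow> E j)"

definition assumption1 ::
    "('n::finite \<Rightarrow> 'x set) \<Rightarrow> ('m \<Rightarrow> 'e::real_inner set) \<Rightarrow> ('m \<Rightarrow> 'e \<Rightarrow> real)
      \<Rightarrow> ('n \<Rightarrow> 'm \<Rightarrow> 'x \<Rightarrow> 'e) \<Rightarrow> ('m \<Rightarrow> real) \<Rightarrow> ('m \<Rightarrow> real) \<Rightarrow> bool" where
  "assumption1 X E f g L L' \<longleftrightarrow>
     (\<forall>i j. bounded (range_ij X g i j)) \<and>
     (\<forall>j. lipschitz_on (L j) (convex hull (range_j X g j)) (f j)) \<and>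
     (\<forall>j. C1_near (E j) (f j) (convex hull (range_j X g j)) \<and>
          lipschitz_on (L' j) (convex hull (range_j X g j)) (gradient (E j) (f j)))"

definition assumption2 ::
    "('n::finite \<Rightarrow> 'x set) \<Rightarrow> ('m \<Rightarrow> 'e::real_inner \<Rightarrow> real) \<Rightarrow> ('n \<Rightarrow> 'm \<Rightarrow> 'x \<Rightarrow> 'e) \<Rightarrow> bool" where
  "assumption2 X f g \<longleftrightarrow> (\<forall>j. convex_on (convex hull (range_j X g j)) (f j))"

definition price_set ::
    "('n::finite \<Rightarrow> 'x set) \<Rightarrow> ('m::finite \<Rightarrow> 'e::real_inner set) \<Rightarrow> ('m \<Rightarrow> 'e \<Rightarrow> real)
      \<Rightarrow> ('n \<Rightarrow> 'm \<Rightarrow> 'x \<Rightarrow> 'e) \<Rightarrow> ('e ^ 'm) set" where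
  "price_set X E f g = gradient (obs_space E) (social f) ` (convex hull (agg g ` dec_space X))"

text \<open>Solvability of the subproblems is witnessed by the fixed selection \<open>S\<close> of solutions.\<close>

definition assumption3 ::
    "('n::finite \<Rightarrow> 'x set) \<Rightarrow> ('m::finite \<Rightarrow> 'e::real_inner set) \<Rightarrow> ('m \<Rightarrow> 'e \<Rightarrow> real)
      \<Rightarrow> ('n \<Rightarrow> 'm \<Rightarrow> 'x \<Rightarrow> 'e) \<Rightarrow> ('n \<Rightarrow> 'e ^ 'm \<Rightarrow> 'x) \<Rightarrow> bool" where
  "assumption3 X E f g S \<longleftrightarrow>
     (\<forall>i. \<forall>l\<in>price_set X E f g. is_arg_min (\<lambda>z. l \<bullet> contrib g i z) (\<lambda>z. z \<in> X i) (S i l))"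

definition C0 ::
    "('n::finite \<Rightarrow> 'x set) \<Rightarrow> ('n \<Rightarrow> 'm::finite \<Rightarrow> 'x \<Rightarrow> 'e::metric_space) \<Rightarrow> ('m \<Rightarrow> real) \<Rightarrow> real" where
  "C0 X g L = (\<Sum>j\<in>UNIV. L j * Max (range (\<lambda>i. diam X g i j)))"

definition C1 ::
    "('n::finite \<Rightarrow> 'x set) \<Rightarrow> ('n \<Rightarrow> 'm::finite \<Rightarrow> 'x \<Rightarrow> 'e::metric_space) \<Rightarrow> ('m \<Rightarrow> real) \<Rightarrow> real" where
  "C1 X g L' = 1 / real CARD('n) * (\<Sum>j\<in>UNIV. L' j * (\<Sum>i\<in>UNIV. (diam X g i j)\<^sup>2))"


subsection \<open>The stochastic Frank-Wolfe algorithm\<close>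

definition step_size :: "nat \<Rightarrow> real" where
  "step_size k = 2 / (real k + 2)"

text \<open>\<open>P k j i\<close> is the Bernoulli variable of iteration \<open>k\<close>, sample \<open>j \<in> {1..n k}\<close> and agent \<open>i\<close>.\<close>

definition sfw_samples ::
    "'w measure \<Rightarrow> (nat \<Rightarrow> nat) \<Rightarrow> (nat \<Rightarrow> nat \<Rightarrow> 'n \<Rightarrow> 'w \<Rightarrow> bool) \<Rightarrow> bool" where
  "sfw_samples \<Omega> n P \<longleftrightarrow>
     prob_space.indep_vars \<Omega> (\<lambda>_. count_space UNIV) (\<lambda>(k, j, i). P k j i)
       {(k, j, i). j \<in> {1..n k}} \<and>
     (\<forall>k i. \<forall>j\<in>{1..n k}.
        distr \<Omega> (count_space UNIV) (P k j i) = measure_pmf (bernoulli_pmf (step_size k)))"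

definition sfw_candidate ::
    "('m::finite \<Rightarrow> 'e::real_inner set) \<Rightarrow> ('m \<Rightarrow> 'e \<Rightarrow> real) \<Rightarrow> ('n::finite \<Rightarrow> 'm \<Rightarrow> 'x \<Rightarrow> 'e)
      \<Rightarrow> ('n \<Rightarrow> 'e ^ 'm \<Rightarrow> 'x) \<Rightarrow> ('n \<Rightarrow> 'x) \<Rightarrow> ('n \<Rightarrow> bool) \<Rightarrow> 'n \<Rightarrow> 'x" where
  "sfw_candidate E f g S z b =
     (\<lambda>i. if b i then S i (gradient (obs_space E) (social f) (agg g z)) else z i)"

text \<open>
  The last conjunct is the requirement on the tie-breaking: \<open>x k\<close> is a function of the variables drawn
  before iteration \<open>k\<close>.
\<close>

definition sfw_iterates ::
    "('n::finite \<Rightarrow> 'x set) \<Rightarrow> ('m::finite \<Rightarrow> 'e::real_inner set) \<Rightarrow> ('m \<Rightarrow> 'e \<Rightarrow> real)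
      \<Rightarrow> ('n \<Rightarrow> 'm \<Rightarrow> 'x \<Rightarrow> 'e) \<Rightarrow> ('n \<Rightarrow> 'e ^ 'm \<Rightarrow> 'x)
      \<Rightarrow> 'w measure \<Rightarrow> (nat \<Rightarrow> nat) \<Rightarrow> (nat \<Rightarrow> nat \<Rightarrow> 'n \<Rightarrow> 'w \<Rightarrow> bool)
      \<Rightarrow> (nat \<Rightarrow> 'w \<Rightarrow> 'n \<Rightarrow> 'x) \<Rightarrow> bool" where
  "sfw_iterates X E f g S \<Omega> n P x \<longleftrightarrow>
     (\<exists>x0\<in>dec_space X. \<forall>w\<in>space \<Omega>. x 0 w = x0) \<and>
     (\<forall>k. \<forall>w\<in>space \<Omega>.
        is_arg_min (cost f g)
          (\<lambda>z. z \<in> {sfw_candidate E f g S (x k w) (\<lambda>i. P k j i w) | j. j \<in> {1..n k}})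
          (x (Suc k) w)) \<and>
     (\<forall>k. \<forall>w\<in>space \<Omega>. \<forall>w'\<in>space \<Omega>.
        (\<forall>k'<k. \<forall>j\<in>{1..n k'}. \<forall>i. P k' j i w = P k' j i w') \<longrightarrow> x k w = x k w')"


subsection \<open>The quantities in the concentration bound\<close>

definition v_bound :: "real \<Rightarrow> (nat \<Rightarrow> nat) \<Rightarrow> nat \<Rightarrow> real" where
  "v_bound c n K =
     2 * c\<^sup>2 / ((real K)\<^sup>2 * (real K + 1)\<^sup>2) * (\<Sum>k\<in>{1..K-1}. real k * (real k + 1)\<^sup>2 / real (n k))"

text \<open>A maximum over the empty range is \<open>0\<close> by convention, whereas \<open>Max {}\<close> is unspecified.\<close>

definition m_bound :: "real \<Rightarrow> (nat \<Rightarrow> nat) \<Rightarrow> nat \<Rightarrow> real" where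
  "m_bound c n K =
     c / (real K * (real K + 1)) *
       (if K = 1 then 0 else Max ((\<lambda>k. (real k + 1) * (real k + 2) / real (n k)) ` {1..K-1}))"

text \<open>For \<open>K = 1\<close> the denominator vanishes and the exponential is read as \<open>0\<close>.\<close>

definition exp_term :: "real \<Rightarrow> (nat \<Rightarrow> nat) \<Rightarrow> nat \<Rightarrow> real \<Rightarrow> real \<Rightarrow> real" where
  "exp_term c n K N \<epsilon> =
     (if K = 1 then 0
      else exp (- (\<epsilon>\<^sup>2 * N) / (2 * (v_bound c n K + \<epsilon> * m_bound c n K / 3))))"

end

(*
  Write gamma_k for the gap at x^k. Convexity and smoothness, together with the variance of the
  Bernoulli draws, bound the conditional mean of the average candidate cost at iteration k; as
  x^{k+1} is at least as good as the average candidate, for k < 2N this gives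
    (k+1)(k+2) gamma_{k+1} <= k(k+1) gamma_k + 4 C1 + Z_k
  with a martingale difference Z_k. Summing, gamma_K <= 4 C1 / K + M_K / (K(K+1)) with a martingale M_K.
  Flipping one bit at iteration k changes Z_k by at most (k+1)(k+2) C0 / (N n_k), so revealing the
  bits one at a time bounds the second moment of M_K and, as in Freedman's inequality, its tail.
  The gap is a function of finitely many bits, hence all of this takes place on a finite product
  of Bernoulli distributions.
*)
theory Submission
  imports Defs
begin

text \<open>The conditional law of the best candidate is hard to control, whereas the average
  candidate is linear in the samples: one bit enters only one of its \<open>n k\<close> summands.
  Working with single bits rather than whole samples is what gains the factor 1/N: iteration k has N
  * n_k independent bits, each moving the average by order C0 / (N n_k), so their variances add up
  to order C0^2 / (N n_k).

  Step sizes and difference bounds do not depend on the history, so the conditional variances have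
  deterministic bounds, and the predictable variation in Freedman's inequality is replaced by a
  number.

  At iteration 0 the step size is 1 and the bits are constant. They carry no variance, and the
  maximum in \<open>m_bound\<close> starts at 1, so the uniform bound \<open>B\<close> on the
  differences may be asked only of bits with \<open>p a < 1\<close>.

  Measurability of the iterates is not assumed. It follows from the last clause of
  \<open>sfw_iterates\<close>, since only finitely many histories exist.\<close>

section \<open>Exponential moments of a centred two-valued variable\<close>

text \<open>From the quadratic term on, the exponential series is dominated by a geometric series of
  ratio \<open>u / 3\<close>, because (k+2)! is at least 2 * 3^k.\<close>

lemma exp_Bernstein:
  fixes x u :: real
  assumes "\<bar>x\<bar> \<le> u" "u < 3"
  shows "exp x \<le> 1 + x + x\<^sup>2 / (2 * (1 - u / 3))"
proof -
  have u: "0 \<le> u / 3" "u / 3 < 1" using assms by auto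
  have fact_ge: "2 * 3 ^ k \<le> (fact (k + 2) :: real)" for k
  proof (induction k)
    case (Suc k)
    have "2 * 3 ^ Suc k = 3 * (2 * 3 ^ k :: real)" by simp
    also have "\<dots> \<le> (real k + 3) * fact (k + 2)"
      using Suc by (intro mult_mono) auto
    finally show ?case by (simp add: algebra_simps)
  qed (simp add: eval_nat_numeral)
  have le: "inverse (fact (k + 2)) * x ^ (k + 2) \<le> x\<^sup>2 / 2 * (u / 3) ^ k" for k
  proof -
    have "\<bar>x ^ (k + 2)\<bar> = x\<^sup>2 * \<bar>x\<bar> ^ k" by (simp add: power_abs power_add abs_mult power2_eq_square)
    also have "\<dots> \<le> x\<^sup>2 * u ^ k" using assms by (intro mult_left_mono power_mono) auto
    finally have x: "\<bar>x ^ (k + 2)\<bar> \<le> x\<^sup>2 * u ^ k" .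
    have "inverse (fact (k + 2)) * x ^ (k + 2) \<le> inverse (fact (k + 2)) * \<bar>x ^ (k + 2)\<bar>"
      by (intro mult_left_mono) auto
    also have "\<dots> \<le> inverse (2 * 3 ^ k) * (x\<^sup>2 * u ^ k)"
      using assms by (intro mult_mono le_imp_inverse_le fact_ge x) auto
    finally show ?thesis by (simp add: field_simps)
  qed
  have "exp x = 1 + x + (\<Sum>k. inverse (fact (k + 2)) * x ^ (k + 2))"
    using exp_first_two_terms[of x] by simp
  also have "(\<Sum>k. inverse (fact (k + 2)) * x ^ (k + 2)) \<le> (\<Sum>k. x\<^sup>2 / 2 * (u / 3) ^ k)"
    using summable_exp[of x] u
    by (intro suminf_le le summable_mult summable_geometric)
      (simp_all only: summable_iff_shift[where f = "\<lambda>n. inverse (fact n) * x ^ n"], auto)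
  also have "\<dots> = x\<^sup>2 / (2 * (1 - u / 3))"
    using u by (subst suminf_mult) (auto simp: summable_geometric suminf_geometric)
  finally show ?thesis by simp
qed

text \<open>The variable equal to (1-p)\<delta> with probability p and to -p\<delta> otherwise has
  mean 0 and variance p(1-p)\<delta>^2, so the linear term of \<open>exp_Bernstein\<close> cancels.
  For p = 1 it vanishes, hence \<open>c\<close> may then exceed \<open>B\<close>.\<close>

lemma Bernoulli_mgf:
  fixes p \<delta> c \<theta> B :: real
  assumes "0 \<le> p" "p \<le> 1" "\<bar>\<delta>\<bar> \<le> c" "p < 1 \<Longrightarrow> c \<le> B" "0 \<le> \<theta>" "\<theta> * B < 3"
  shows "p * exp (\<theta> * ((1 - p) * \<delta>)) + (1 - p) * exp (\<theta> * (- p * \<delta>))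
    \<le> exp (\<theta>\<^sup>2 / (2 * (1 - \<theta> * B / 3)) * (p * (1 - p) * c\<^sup>2))"
proof (cases "p = 1")
  case False
  define \<kappa> where "\<kappa> = 1 / (2 * (1 - \<theta> * B / 3))"
  have \<kappa>: "0 \<le> \<kappa>" using assms by (simp add: \<kappa>_def mult.commute)
  have p: "p < 1" using False assms by simp
  have \<delta>: "\<theta> * \<bar>\<delta>\<bar> \<le> \<theta> * B" using assms p by (intro mult_left_mono) auto
  have q: "exp (\<theta> * (q * \<delta>)) \<le> 1 + \<theta> * (q * \<delta>) + \<kappa> * (\<theta> * (q * \<delta>))\<^sup>2" if "\<bar>q\<bar> \<le> 1" for q
  proof -
    have "\<bar>\<theta> * (q * \<delta>)\<bar> = \<bar>q\<bar> * (\<theta> * \<bar>\<delta>\<bar>)" using assms by (simp add: abs_mult)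
    also have "\<dots> \<le> 1 * (\<theta> * \<bar>\<delta>\<bar>)" using assms that by (intro mult_right_mono) auto
    finally have "\<bar>\<theta> * (q * \<delta>)\<bar> \<le> \<theta> * B" using \<delta> by simp
    from exp_Bernstein[OF this] assms show ?thesis by (simp add: \<kappa>_def)
  qed
  have "p * exp (\<theta> * ((1 - p) * \<delta>)) + (1 - p) * exp (\<theta> * (- p * \<delta>))
    \<le> p * (1 + \<theta> * ((1 - p) * \<delta>) + \<kappa> * (\<theta> * ((1 - p) * \<delta>))\<^sup>2)
      + (1 - p) * (1 + \<theta> * (- p * \<delta>) + \<kappa> * (\<theta> * (- p * \<delta>))\<^sup>2)"
    using assms by (intro add_mono mult_left_mono q) auto
  also have "\<dots> = 1 + \<theta>\<^sup>2 * \<kappa> * (p * (1 - p) * \<delta>\<^sup>2)"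
    by (simp add: algebra_simps power2_eq_square)
  also have "\<dots> \<le> 1 + \<theta>\<^sup>2 * \<kappa> * (p * (1 - p) * c\<^sup>2)"
    using assms p \<kappa> by (intro add_left_mono mult_left_mono power2_le_iff_abs_le[THEN iffD2]) auto
  also have "\<dots> \<le> exp (\<theta>\<^sup>2 * \<kappa> * (p * (1 - p) * c\<^sup>2))" by (rule exp_ge_add_one_self)
  finally show ?thesis by (simp add: \<kappa>_def)
qed (use assms in auto)

subsection \<open>Independent bits\<close>

text \<open>Bits outside \<open>A\<close> are fixed to False. For finite \<open>A\<close> the
  support is therefore finite, and every function of the bits is integrable.\<close>

definition bits :: "'a set \<Rightarrow> ('a \<Rightarrow> real) \<Rightarrow> ('a \<Rightarrow> bool) pmf" where
  "bits A p = Pi_pmf A False (\<lambda>a. bernoulli_pmf (p a))"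

lemma finite_set_bits:
  assumes "finite A"
  shows "finite (set_pmf (bits A p))"
proof -
  have "finite (PiE_dflt A False (set_pmf \<circ> (\<lambda>a. bernoulli_pmf (p a))))"
    using assms by (intro finite_PiE_dflt) auto
  then show ?thesis using assms by (simp add: bits_def set_Pi_pmf)
qed

lemma integrable_bits:
  "finite A \<Longrightarrow> integrable (measure_pmf (bits A p)) (H :: _ \<Rightarrow> 'b::{banach, second_countable_topology})"
  by (intro integrable_measure_pmf_finite finite_set_bits)

lemma expectation_bits_mono:
  fixes H H' :: "('a \<Rightarrow> bool) \<Rightarrow> real"
  assumes "finite A" "\<And>b. H b \<le> H' b"
  shows "measure_pmf.expectation (bits A p) H \<le> measure_pmf.expectation (bits A p) H'"
  using assms by (intro integral_mono integrable_bits)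

lemma expectation_pair_finite:
  fixes H :: "_ \<Rightarrow> real"
  assumes "finite (set_pmf P)" "finite (set_pmf Q)"
  shows "measure_pmf.expectation (pair_pmf P Q) H
    = measure_pmf.expectation P (\<lambda>a. measure_pmf.expectation Q (\<lambda>b. H (a, b)))"
proof -
  have P: "measure_pmf.expectation P h = (\<Sum>a\<in>set_pmf P. pmf P a * h a)" for h :: "_ \<Rightarrow> real"
    using assms by (subst integral_measure_pmf[of "set_pmf P"]) (auto simp: set_pmf_iff)
  have Q: "measure_pmf.expectation Q h = (\<Sum>a\<in>set_pmf Q. pmf Q a * h a)" for h :: "_ \<Rightarrow> real"
    using assms by (subst integral_measure_pmf[of "set_pmf Q"]) (auto simp: set_pmf_iff)
  have "measure_pmf.expectation (pair_pmf P Q) H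
    = (\<Sum>z\<in>set_pmf P \<times> set_pmf Q. pmf (pair_pmf P Q) z * H z)"
    using assms by (subst integral_measure_pmf[of "set_pmf P \<times> set_pmf Q"]) (auto simp: set_pmf_iff)
  then show ?thesis
    by (simp add: P Q sum.cartesian_product' pmf_pair sum_distrib_left mult.assoc)
qed

text \<open>With \<open>A\<close> the past and \<open>B\<close> the next block, the inner integral
  is the conditional expectation given the history; no conditional expectation operator is
  needed.\<close>

lemma expectation_bits_union:
  fixes H :: "_ \<Rightarrow> real"
  assumes "finite A" "finite B" "A \<inter> B = {}"
  shows "measure_pmf.expectation (bits (A \<union> B) p) H
    = measure_pmf.expectation (bits A p) (\<lambda>b. measure_pmf.expectation (bits B p)
        (\<lambda>b'. H (\<lambda>t. if t \<in> A then b t else b' t)))"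
proof -
  note fin = finite_set_bits[unfolded bits_def]
  show ?thesis
    using assms unfolding bits_def
    by (subst Pi_pmf_union) (auto simp: expectation_pair_finite fin case_prod_beta)
qed

lemma expectation_bits_insert:
  fixes H :: "_ \<Rightarrow> real"
  assumes "finite A" "a \<notin> A" "0 \<le> p a" "p a \<le> 1"
  shows "measure_pmf.expectation (bits (insert a A) p) H
    = measure_pmf.expectation (bits A p) (\<lambda>b. p a * H (b(a := True)) + (1 - p a) * H (b(a := False)))"
proof -
  note fin = finite_set_bits[unfolded bits_def]
  note int = integrable_bits[unfolded bits_def]
  have "finite (set_pmf (bernoulli_pmf (p a)))" by (rule finite_subset[of _ UNIV]) auto
  then show ?thesis
    using assms unfolding bits_def
    by (subst Pi_pmf_insert)
      (auto simp: expectation_pair_finite fin int case_prod_beta integral_add)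
qed

text \<open>
  Both bounds of this lemma tensorize: averaging out one bit leaves a function with the same bounded
  differences, and contributes the factor of \<open>Bernoulli_mgf\<close>, respectively one variance term.
\<close>

lemma bounded_differences_bits:
  fixes F :: "('a \<Rightarrow> bool) \<Rightarrow> real" and p c :: "'a \<Rightarrow> real" and \<theta> B :: real
  assumes "finite A"
    and "\<And>a. a \<in> A \<Longrightarrow> 0 \<le> p a \<and> p a \<le> 1"
    and "\<And>a b. a \<in> A \<Longrightarrow> \<bar>F (b(a := True)) - F (b(a := False))\<bar> \<le> c a"
  shows expectation_exp_bits:
      "\<lbrakk>0 \<le> \<theta>; \<theta> * B < 3; \<And>a. a \<in> A \<Longrightarrow> p a < 1 \<Longrightarrow> c a \<le> B\<rbrakk> \<Longrightarrow>
        measure_pmf.expectation (bits A p) (\<lambda>b. exp (\<theta> * (F b - measure_pmf.expectation (bits A p) F)))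
          \<le> exp (\<theta>\<^sup>2 / (2 * (1 - \<theta> * B / 3)) * (\<Sum>a\<in>A. p a * (1 - p a) * (c a)\<^sup>2))"
    and variance_bits:
      "measure_pmf.expectation (bits A p) (\<lambda>b. (F b - measure_pmf.expectation (bits A p) F)\<^sup>2)
          \<le> (\<Sum>a\<in>A. p a * (1 - p a) * (c a)\<^sup>2)"
proof -
  \<comment> \<open>Both bounds are proved in one induction because they share the averaged function
    \<open>F'\<close>; the conditions on \<theta> become an implication since only the exponential
    bound needs them.\<close>
  have *: "(0 \<le> \<theta> \<and> \<theta> * B < 3 \<and> (\<forall>a\<in>A. p a < 1 \<longrightarrow> c a \<le> B) \<longrightarrow>
        measure_pmf.expectation (bits A p) (\<lambda>b. exp (\<theta> * (F b - measure_pmf.expectation (bits A p) F)))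
          \<le> exp (\<theta>\<^sup>2 / (2 * (1 - \<theta> * B / 3)) * (\<Sum>a\<in>A. p a * (1 - p a) * (c a)\<^sup>2)))
    \<and> measure_pmf.expectation (bits A p) (\<lambda>b. (F b - measure_pmf.expectation (bits A p) F)\<^sup>2)
          \<le> (\<Sum>a\<in>A. p a * (1 - p a) * (c a)\<^sup>2)"
    using assms
  proof (induction A arbitrary: F rule: finite_induct)
    case empty
    then show ?case by (simp add: bits_def)
  next
    case (insert a A)
    define q where "q = p a"
    define F' where "F' b = q * F (b(a := True)) + (1 - q) * F (b(a := False))" for b
    define \<delta> where "\<delta> b = F (b(a := True)) - F (b(a := False))" for b
    define m where "m = measure_pmf.expectation (bits A p) F'"
    have q: "0 \<le> q" "q \<le> 1" using insert.prems(1)[of a] by (auto simp: q_def)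
    have E: "measure_pmf.expectation (bits (insert a A) p) H
      = measure_pmf.expectation (bits A p) (\<lambda>b. q * H (b(a := True)) + (1 - q) * H (b(a := False)))" for H
      unfolding q_def using insert q by (intro expectation_bits_insert) (auto simp: q_def)
    have m: "measure_pmf.expectation (bits (insert a A) p) F = m" by (simp add: E m_def F'_def[abs_def])
    have d: "\<bar>\<delta> b\<bar> \<le> c a" for b unfolding \<delta>_def by (rule insert.prems(2)) simp
    \<comment> \<open>The deviation splits into that of the averaged function and a two-valued
      variable which is centred in the bit \<open>a\<close> alone.\<close>
    have d1: "F (b(a := True)) - m = (F' b - m) + (1 - q) * \<delta> b"
      and d0: "F (b(a := False)) - m = (F' b - m) + (- q * \<delta> b)" for b
      by (simp_all add: F'_def \<delta>_def algebra_simps)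
    have F'_bd: "\<bar>F' (b(t := True)) - F' (b(t := False))\<bar> \<le> c t" if "t \<in> A" for b t
    proof -
      have [simp]: "t \<noteq> a" "a \<noteq> t" using that insert by auto
      have b1: "\<bar>F (b(t := True, a := v)) - F (b(t := False, a := v))\<bar> \<le> c t" for v
      proof -
        have "\<bar>F (b(a := v, t := True)) - F (b(a := v, t := False))\<bar> \<le> c t"
          by (rule insert.prems(2)) (use that in simp)
        then show ?thesis by (simp only: fun_upd_twist[OF \<open>t \<noteq> a\<close>])
      qed
      have "F' (b(t := True)) - F' (b(t := False))
        = q * (F (b(t := True, a := True)) - F (b(t := False, a := True)))
        + (1 - q) * (F (b(t := True, a := False)) - F (b(t := False, a := False)))"
        by (simp add: F'_def algebra_simps)
      also have "\<bar>\<dots>\<bar> \<le> q * c t + (1 - q) * c t"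
        using q b1 by (intro order_trans[OF abs_triangle_ineq] add_mono)
          (auto simp: abs_mult intro!: mult_left_mono)
      finally show ?thesis by (simp add: algebra_simps)
    qed
    have IH: "(0 \<le> \<theta> \<and> \<theta> * B < 3 \<and> (\<forall>a\<in>A. p a < 1 \<longrightarrow> c a \<le> B) \<longrightarrow>
        measure_pmf.expectation (bits A p) (\<lambda>b. exp (\<theta> * (F' b - m)))
          \<le> exp (\<theta>\<^sup>2 / (2 * (1 - \<theta> * B / 3)) * (\<Sum>a\<in>A. p a * (1 - p a) * (c a)\<^sup>2)))
      \<and> measure_pmf.expectation (bits A p) (\<lambda>b. (F' b - m)\<^sup>2) \<le> (\<Sum>a\<in>A. p a * (1 - p a) * (c a)\<^sup>2)"
      unfolding m_def by (rule insert.IH) (simp add: insert.prems(1), erule F'_bd)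
    show ?case
    proof (intro conjI impI, goal_cases)
      case 1
      define s where "s = \<theta>\<^sup>2 / (2 * (1 - \<theta> * B / 3)) * (q * (1 - q) * (c a)\<^sup>2)"
      have "measure_pmf.expectation (bits (insert a A) p) (\<lambda>b. exp (\<theta> * (F b - m)))
        = measure_pmf.expectation (bits A p) (\<lambda>b. exp (\<theta> * (F' b - m)) *
            (q * exp (\<theta> * ((1 - q) * \<delta> b)) + (1 - q) * exp (\<theta> * (- q * \<delta> b))))"
        by (simp only: E d1 d0 distrib_left exp_add) (simp add: mult_ac)
      also have "\<dots> \<le> measure_pmf.expectation (bits A p) (\<lambda>b. exp (\<theta> * (F' b - m)) * exp s)"
        unfolding s_def using 1 q d insert
        by (intro expectation_bits_mono mult_left_mono Bernoulli_mgf) (auto simp: q_def)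
      also have "\<dots> = measure_pmf.expectation (bits A p) (\<lambda>b. exp (\<theta> * (F' b - m))) * exp s"
        by simp
      also have "\<dots> \<le> exp (\<theta>\<^sup>2 / (2 * (1 - \<theta> * B / 3)) * (\<Sum>a\<in>A. p a * (1 - p a) * (c a)\<^sup>2)) * exp s"
        using IH 1 by (intro mult_right_mono) auto
      also have "\<dots> = exp (\<theta>\<^sup>2 / (2 * (1 - \<theta> * B / 3)) * (\<Sum>a\<in>insert a A. p a * (1 - p a) * (c a)\<^sup>2))"
        using insert by (simp add: s_def q_def exp_add[symmetric] distrib_left add.commute)
      finally show ?case by (simp only: m)
    next
      case 2
      \<comment> \<open>The cross terms q(1-q)\<delta> and -(1-q)q\<delta> cancel, leaving the
        variance of the single bit.\<close>
      have "measure_pmf.expectation (bits (insert a A) p) (\<lambda>b. (F b - m)\<^sup>2)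
        = measure_pmf.expectation (bits A p) (\<lambda>b. (F' b - m)\<^sup>2 + q * (1 - q) * (\<delta> b)\<^sup>2)"
        by (simp only: E d1 d0) (simp add: algebra_simps power2_eq_square)
      also have "\<dots> \<le> measure_pmf.expectation (bits A p) (\<lambda>b. (F' b - m)\<^sup>2 + q * (1 - q) * (c a)\<^sup>2)"
        using insert.hyps q d order_trans[OF abs_ge_zero d]
        by (intro expectation_bits_mono add_left_mono mult_left_mono)
          (auto intro!: power2_le_iff_abs_le[THEN iffD2])
      also have "\<dots> = measure_pmf.expectation (bits A p) (\<lambda>b. (F' b - m)\<^sup>2) + q * (1 - q) * (c a)\<^sup>2"
        using insert by (simp add: integral_add integrable_bits)
      also have "\<dots> \<le> (\<Sum>a\<in>insert a A. p a * (1 - p a) * (c a)\<^sup>2)"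
        using IH insert by (simp add: q_def)
      finally show ?case by (simp only: m)
    qed
  qed
  show "\<lbrakk>0 \<le> \<theta>; \<theta> * B < 3; \<And>a. a \<in> A \<Longrightarrow> p a < 1 \<Longrightarrow> c a \<le> B\<rbrakk> \<Longrightarrow>
        measure_pmf.expectation (bits A p) (\<lambda>b. exp (\<theta> * (F b - measure_pmf.expectation (bits A p) F)))
          \<le> exp (\<theta>\<^sup>2 / (2 * (1 - \<theta> * B / 3)) * (\<Sum>a\<in>A. p a * (1 - p a) * (c a)\<^sup>2))"
    using * by blast
  show "measure_pmf.expectation (bits A p) (\<lambda>b. (F b - measure_pmf.expectation (bits A p) F)\<^sup>2)
          \<le> (\<Sum>a\<in>A. p a * (1 - p a) * (c a)\<^sup>2)"
    using * by blast
qed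

subsection \<open>Adaptive sums of functions of blocks of bits\<close>

definition past :: "(nat \<Rightarrow> 'a set) \<Rightarrow> nat \<Rightarrow> 'a set" where
  "past A k = (\<Union>l<k. A l)"

text \<open>A canonical representative of the bits seen so far: sequences that agree on
  \<open>I\<close> have the same restriction, and with \<open>I\<close> finite only finitely many
  restrictions exist.\<close>

definition restr :: "'a set \<Rightarrow> ('a \<Rightarrow> bool) \<Rightarrow> 'a \<Rightarrow> bool" where
  "restr I b = (\<lambda>t. t \<in> I \<and> b t)"

text \<open>
  In \<open>F k h b\<close> the argument \<open>h\<close> is the history, that is, the bits of the blocks before \<open>k\<close>. As \<open>F k h\<close>
  is a centred function of the \<open>k\<close>-th block for each \<open>h\<close>, the sums \<open>M k\<close> below form a martingale.
\<close>

locale adaptive_bits =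
  fixes A :: "nat \<Rightarrow> 'a set" and p c :: "'a \<Rightarrow> real"
    and F :: "nat \<Rightarrow> ('a \<Rightarrow> bool) \<Rightarrow> ('a \<Rightarrow> bool) \<Rightarrow> real"
  assumes finite_block: "finite (A k)"
    and disjoint_blocks: "k \<noteq> l \<Longrightarrow> A k \<inter> A l = {}"
    and prob_bounds: "a \<in> A k \<Longrightarrow> 0 \<le> p a \<and> p a \<le> 1"
    and F_block: "(\<And>a. a \<in> A k \<Longrightarrow> b a = b' a) \<Longrightarrow> F k h b = F k h b'"
    and F_centred: "measure_pmf.expectation (bits (A k) p) (F k h) = 0"
    and F_differences: "a \<in> A k \<Longrightarrow> \<bar>F k h (b(a := True)) - F k h (b(a := False))\<bar> \<le> c a"
begin

definition M :: "nat \<Rightarrow> ('a \<Rightarrow> bool) \<Rightarrow> real" where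
  "M k b = (\<Sum>l<k. F l (restr (past A l) b) b)"

definition block_var :: "nat \<Rightarrow> real" where
  "block_var k = (\<Sum>a\<in>A k. p a * (1 - p a) * (c a)\<^sup>2)"

lemma finite_past: "finite (past A k)"
  by (auto simp: past_def finite_block)

lemma past_Suc: "past A (Suc k) = past A k \<union> A k"
  by (auto simp: past_def less_Suc_eq)

lemma past_disjoint: "past A k \<inter> A k = {}"
proof -
  have "A l \<inter> A k = {}" if "l < k" for l using that by (intro disjoint_blocks) simp
  then show ?thesis unfolding past_def by blast
qed

text \<open>\<open>M k\<close> sees only the first \<open>k\<close> blocks, so its law can be
  computed under \<open>bits (past A k) p\<close>.\<close>

lemma M_restr: "M k (restr (past A k) b) = M k b"
  unfolding M_def
proof (rule sum.cong[OF refl])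
  fix l assume l: "l \<in> {..<k}"
  have "restr (past A l) (restr (past A k) b) = restr (past A l) b"
    using l by (force simp: restr_def past_def)
  moreover have "F l h (restr (past A k) b) = F l h b" for h
    using l by (intro F_block) (auto simp: restr_def past_def)
  ultimately show "F l (restr (past A l) (restr (past A k) b)) (restr (past A k) b) = F l (restr (past A l) b) b"
    by simp
qed

text \<open>Glues a past \<open>b\<close> to a fresh block \<open>b'\<close>, in the form in which
  \<open>expectation_bits_union\<close> presents them: only the last increment involves
  \<open>b'\<close>.\<close>

lemma M_merge:
  "M (Suc k) (\<lambda>t. if t \<in> past A k then b t else b' t) = M k b + F k (restr (past A k) b) b'"
proof -
  let ?m = "\<lambda>t. if t \<in> past A k then b t else b' t"
  have "F l (restr (past A l) ?m) ?m = F l (restr (past A l) b) b" if "l < k" for l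
  proof -
    have "restr (past A l) ?m = restr (past A l) b"
      using that by (fastforce simp: restr_def past_def)
    moreover have "F l h ?m = F l h b" for h
      using that by (intro F_block) (auto simp: past_def)
    ultimately show ?thesis by simp
  qed
  then have "(\<Sum>l<k. F l (restr (past A l) ?m) ?m) = M k b"
    unfolding M_def by (intro sum.cong) auto
  moreover have "restr (past A k) ?m = restr (past A k) b" by (auto simp: restr_def)
  moreover have "F k h ?m = F k h b'" for h
    using past_disjoint[of k] by (intro F_block) auto
  ultimately show ?thesis unfolding M_def[of "Suc k"] by (simp only: sum.lessThan_Suc)
qed

lemma expectation_M_Suc:
  fixes \<phi> :: "real \<Rightarrow> real"
  shows "measure_pmf.expectation (bits (past A (Suc k)) p) (\<lambda>b. \<phi> (M (Suc k) b))
    = measure_pmf.expectation (bits (past A k) p) (\<lambda>b.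
        measure_pmf.expectation (bits (A k) p) (\<lambda>b'. \<phi> (M k b + F k (restr (past A k) b) b')))"
  unfolding past_Suc
  by (subst expectation_bits_union[OF finite_past finite_block past_disjoint]) (simp only: M_merge)

lemma expectation_M: "measure_pmf.expectation (bits (past A k) p) (M k) = 0"
proof (induction k)
  case (Suc k)
  have "measure_pmf.expectation (bits (past A (Suc k)) p) (M (Suc k))
    = measure_pmf.expectation (bits (past A k) p) (\<lambda>b. M k b)"
    using expectation_M_Suc[of k "\<lambda>u. u"]
    by (simp add: integral_add integrable_bits finite_block F_centred)
  then show ?case using Suc by simp
qed (simp add: M_def)

lemma block_second_moment:
  "measure_pmf.expectation (bits (A k) p) (\<lambda>b. (F k h b)\<^sup>2) \<le> block_var k"
proof -
  have "measure_pmf.expectation (bits (A k) p)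
      (\<lambda>b. (F k h b - measure_pmf.expectation (bits (A k) p) (F k h))\<^sup>2) \<le> block_var k"
    unfolding block_var_def
    by (rule variance_bits[OF finite_block]) (erule prob_bounds, erule F_differences)
  then show ?thesis by (simp add: F_centred)
qed

text \<open>Increments are orthogonal: for a fixed past, the cross term is a constant times the
  integral of the centred \<open>F k h\<close>, and the squares are bounded block by block.\<close>

lemma second_moment_M:
  "measure_pmf.expectation (bits (past A k) p) (\<lambda>b. (M k b)\<^sup>2) \<le> (\<Sum>l<k. block_var l)"
proof (induction k)
  case (Suc k)
  have "measure_pmf.expectation (bits (past A (Suc k)) p) (\<lambda>b. (M (Suc k) b)\<^sup>2)
    = measure_pmf.expectation (bits (past A k) p) (\<lambda>b. (M k b)\<^sup>2 +
        measure_pmf.expectation (bits (A k) p) (\<lambda>b'. (F k (restr (past A k) b) b')\<^sup>2))"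
    by (simp add: expectation_M_Suc[of k "\<lambda>u. u\<^sup>2"] power2_sum integral_add integrable_bits
        finite_block F_centred)
  also have "\<dots> \<le> measure_pmf.expectation (bits (past A k) p) (\<lambda>b. (M k b)\<^sup>2 + block_var k)"
    by (intro expectation_bits_mono finite_past add_left_mono block_second_moment)
  also have "\<dots> = measure_pmf.expectation (bits (past A k) p) (\<lambda>b. (M k b)\<^sup>2) + block_var k"
    by (simp add: integral_add integrable_bits finite_past)
  finally show ?case using Suc by simp
qed (simp add: M_def)

text \<open>The bound for a block is uniform in the history \<open>h\<close>, so it can be pulled
  out of the integral over the past, and the factors multiply along the induction.\<close>

lemma mgf_M:
  assumes "0 \<le> \<theta>" "\<theta> * B < 3" "\<And>l a. l < k \<Longrightarrow> a \<in> A l \<Longrightarrow> p a < 1 \<Longrightarrow> c a \<le> B"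
  shows "measure_pmf.expectation (bits (past A k) p) (\<lambda>b. exp (\<theta> * M k b))
    \<le> exp (\<theta>\<^sup>2 / (2 * (1 - \<theta> * B / 3)) * (\<Sum>l<k. block_var l))"
  using assms(3)
proof (induction k)
  case (Suc k)
  define \<kappa> where "\<kappa> = \<theta>\<^sup>2 / (2 * (1 - \<theta> * B / 3))"
  have block: "measure_pmf.expectation (bits (A k) p) (\<lambda>b. exp (\<theta> * F k h b)) \<le> exp (\<kappa> * block_var k)" for h
  proof -
    have "measure_pmf.expectation (bits (A k) p)
        (\<lambda>b. exp (\<theta> * (F k h b - measure_pmf.expectation (bits (A k) p) (F k h)))) \<le> exp (\<kappa> * block_var k)"
      unfolding block_var_def \<kappa>_def
      by (rule expectation_exp_bits[OF finite_block _ _ assms(1,2)])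
        (erule prob_bounds, erule F_differences, erule (1) Suc.prems[OF lessI])
    then show ?thesis by (simp add: F_centred)
  qed
  have "measure_pmf.expectation (bits (past A (Suc k)) p) (\<lambda>b. exp (\<theta> * M (Suc k) b))
    = measure_pmf.expectation (bits (past A k) p) (\<lambda>b. exp (\<theta> * M k b) *
        measure_pmf.expectation (bits (A k) p) (\<lambda>b'. exp (\<theta> * F k (restr (past A k) b) b')))"
    by (simp add: expectation_M_Suc[of k "\<lambda>u. exp (\<theta> * u)"] distrib_left exp_add)
  also have "\<dots> \<le> measure_pmf.expectation (bits (past A k) p)
      (\<lambda>b. exp (\<theta> * M k b) * exp (\<kappa> * block_var k))"
    by (intro expectation_bits_mono finite_past mult_left_mono block) simp
  also have "\<dots> = measure_pmf.expectation (bits (past A k) p) (\<lambda>b. exp (\<theta> * M k b)) * exp (\<kappa> * block_var k)"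
    by simp
  also have "\<dots> \<le> exp (\<kappa> * (\<Sum>l<k. block_var l)) * exp (\<kappa> * block_var k)"
    unfolding \<kappa>_def by (intro mult_right_mono Suc.IH Suc.prems) (auto intro: less_SucI)
  also have "\<dots> = exp (\<kappa> * (\<Sum>l<Suc k. block_var l))"
    by (simp add: exp_add[symmetric] distrib_left)
  finally show ?case by (simp only: \<kappa>_def)
qed (simp add: M_def)

text \<open>Chernoff's bound with \<open>\<theta> = t / (V + B t / 3)\<close>, for which \<open>1 - \<theta> B / 3 = V / (V + B t / 3)\<close>.\<close>

lemma Freedman_M:
  assumes "0 < t" "0 \<le> B" "\<And>l a. l < k \<Longrightarrow> a \<in> A l \<Longrightarrow> p a < 1 \<Longrightarrow> c a \<le> B"
    and V: "(\<Sum>l<k. block_var l) \<le> V" "0 < V"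
  shows "measure_pmf.prob (bits (past A k) p) {b. t \<le> M k b} \<le> exp (- t\<^sup>2 / (2 * (V + B * t / 3)))"
proof -
  define W where "W = V + B * t / 3"
  define \<theta> where "\<theta> = t / W"
  have W: "0 < W" using assms by (simp add: W_def add_pos_nonneg)
  have \<theta>: "0 < \<theta>" using W assms by (simp add: \<theta>_def)
  have eq: "1 - \<theta> * B / 3 = V / W" using W by (simp add: \<theta>_def W_def field_simps)
  have "0 < V / W" using W V by simp
  then have \<theta>B: "\<theta> * B < 3" using eq by simp
  have "exp (\<theta> * t) * measure_pmf.prob (bits (past A k) p) {b. t \<le> M k b}
    = measure_pmf.expectation (bits (past A k) p) (\<lambda>b. exp (\<theta> * t) * indicator {b. t \<le> M k b} b)"
    by simp
  also have "\<dots> \<le> measure_pmf.expectation (bits (past A k) p) (\<lambda>b. exp (\<theta> * M k b))"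
    using \<theta> by (intro expectation_bits_mono finite_past) (auto simp: indicator_def)
  also have "\<dots> \<le> exp (\<theta>\<^sup>2 / (2 * (1 - \<theta> * B / 3)) * (\<Sum>l<k. block_var l))"
    using \<theta> by (intro mgf_M \<theta>B assms(3)) auto
  also have "\<dots> \<le> exp (\<theta>\<^sup>2 / (2 * (1 - \<theta> * B / 3)) * V)"
    unfolding eq using V W by (intro iffD2[OF exp_le_cancel_iff] mult_left_mono) auto
  also have "\<theta>\<^sup>2 / (2 * (1 - \<theta> * B / 3)) * V = t\<^sup>2 / (2 * W)"
    unfolding eq using V W by (simp add: \<theta>_def field_simps power2_eq_square)
  finally have "measure_pmf.prob (bits (past A k) p) {b. t \<le> M k b} \<le> exp (t\<^sup>2 / (2 * W)) / exp (\<theta> * t)"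
    by (simp add: field_simps)
  also have "\<dots> = exp (- t\<^sup>2 / (2 * W))"
    using W by (simp add: \<theta>_def exp_diff[symmetric] field_simps power2_eq_square)
  finally show ?thesis by (simp add: W_def)
qed

end

text \<open>The bits are cut off to \<open>I\<close> because \<open>bits I p\<close> is supported on functions that vanish outside \<open>I\<close>.\<close>

lemma (in prob_space) distr_eq_bits:
  fixes B :: "'i \<Rightarrow> 'a \<Rightarrow> bool"
  assumes "indep_vars (\<lambda>_. count_space UNIV) B J" "I \<subseteq> J" "finite I"
    and "\<And>i. i \<in> I \<Longrightarrow> distr M (count_space UNIV) (B i) = measure_pmf (bernoulli_pmf (p i))"
  shows "(\<lambda>w i. i \<in> I \<and> B i w) \<in> measurable M (count_space UNIV)"
    and "distr M (count_space UNIV) (\<lambda>w i. i \<in> I \<and> B i w) = measure_pmf (bits I p)"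
proof -
  let ?b = "\<lambda>w i. i \<in> I \<and> B i w"
  \<comment> \<open>All values of the cut-off bit vector lie in this finite set, which reduces
    measurability and equality of the two laws to single points.\<close>
  define R where "R = {b. \<forall>i. i \<notin> I \<longrightarrow> \<not> (b i :: bool)}"
  have fin: "finite R"
  proof (rule finite_subset)
    show "R \<subseteq> PiE_dflt I False (\<lambda>_. UNIV)" by (auto simp: R_def PiE_dflt_def)
    show "finite (PiE_dflt I False (\<lambda>_. UNIV :: bool set))" using assms by (intro finite_PiE_dflt) auto
  qed
  have meas: "B i \<in> measurable M (count_space UNIV)" if "i \<in> I" for i
    using assms(1,2) that by (auto simp: indep_vars_def2)
  \<comment> \<open>The trailing \<open>space M\<close> keeps the identity true for
    \<open>I = {}\<close>, where the intersection is everything. That case is treated apart below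
    because the rules for finite intersections and for independence want a nonempty index
    set.\<close>
  have fibre: "?b -` {b} \<inter> space M = (\<Inter>i\<in>I. B i -` {b i} \<inter> space M) \<inter> space M" if "b \<in> R" for b
  proof -
    have "?b w = b \<longleftrightarrow> (\<forall>i\<in>I. B i w = b i)" for w
      using that unfolding fun_eq_iff R_def by blast
    then show ?thesis by auto
  qed
  have set: "?b -` Y \<inter> space M = (\<Union>b\<in>Y \<inter> R. ?b -` {b} \<inter> space M)" for Y
    by (auto simp: R_def)
  have fibre_sets: "?b -` {b} \<inter> space M \<in> sets M" if "b \<in> R" for b
  proof (cases "I = {}")
    case False
    have "B i -` {b i} \<inter> space M \<in> sets M" if "i \<in> I" for i
      using meas[OF that] by (rule measurable_sets) simp
    then show ?thesis
      unfolding fibre[OF \<open>b \<in> R\<close>] by (rule sets.Int[OF sets.finite_INT[OF assms(3) False] sets.top])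
  qed (use fibre[OF that] in simp)
  show *: "?b \<in> measurable M (count_space UNIV)"
  proof (rule measurableI)
    fix Y :: "('i \<Rightarrow> bool) set"
    show "?b -` Y \<inter> space M \<in> sets M"
      by (subst set, intro sets.finite_UN) (simp_all only: finite_Int fin fibre_sets Int_iff simp_thms)
  qed simp
  have pt: "prob (?b -` {b} \<inter> space M) = pmf (bits I p) b" if b: "b \<in> R" for b
  proof (cases "I = {}")
    case True
    then show ?thesis using b by (auto simp: bits_def R_def prob_space indicator_def fun_eq_iff)
  next
    case False
    have "?b -` {b} \<inter> space M = (\<Inter>i\<in>I. B i -` {b i} \<inter> space M)"
      using fibre[OF b] False by auto
    then have "prob (?b -` {b} \<inter> space M) = (\<Prod>i\<in>I. prob (B i -` {b i} \<inter> space M))"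
      by (simp only:) (rule indep_varsD[OF assms(1) False assms(3,2)], simp)
    also have "\<dots> = (\<Prod>i\<in>I. pmf (bernoulli_pmf (p i)) (b i))"
    proof (rule prod.cong[OF refl])
      fix i assume i: "i \<in> I"
      have "prob (B i -` {b i} \<inter> space M) = measure (distr M (count_space UNIV) (B i)) {b i}"
        using meas[OF i] by (simp add: measure_distr)
      then show "prob (B i -` {b i} \<inter> space M) = pmf (bernoulli_pmf (p i)) (b i)"
        using assms(4)[OF i] by (simp add: measure_pmf_single)
    qed
    also have "\<dots> = pmf (bits I p) b"
      using b assms(3) unfolding bits_def by (subst pmf_Pi') (auto simp: R_def)
    finally show ?thesis .
  qed
  have supp: "set_pmf (bits I p) \<subseteq> R"
    using set_Pi_pmf_subset[OF assms(3), of False] by (auto simp: bits_def R_def)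
  show "distr M (count_space UNIV) ?b = measure_pmf (bits I p)"
  proof (rule measure_eqI)
    fix Y assume "Y \<in> sets (distr M (count_space UNIV) ?b)"
    have "prob (?b -` Y \<inter> space M) = (\<Sum>b\<in>Y \<inter> R. prob (?b -` {b} \<inter> space M))"
        using fin fibre_sets by (subst set, intro finite_measure_finite_Union) (auto simp: disjoint_family_on_def)
    also have "\<dots> = (\<Sum>b\<in>Y \<inter> R. pmf (bits I p) b)"
      using pt by (intro sum.cong) auto
    also have "\<dots> = measure_pmf.prob (bits I p) (Y \<inter> R)"
      using fin by (simp add: measure_measure_pmf_finite)
    also have "\<dots> = measure_pmf.prob (bits I p) Y"
      using supp by (intro measure_prob_cong_0) (auto simp: set_pmf_iff)
    finally show "emeasure (distr M (count_space UNIV) ?b) Y = emeasure (measure_pmf (bits I p)) Y"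
      using * by (simp add: emeasure_distr emeasure_eq_measure measure_pmf.emeasure_eq_measure)
  qed simp
qed

section \<open>First and second moments of linear functions of the bits\<close>

lemma expectation_affine_bits:
  assumes "finite A" "\<And>a. a \<in> A \<Longrightarrow> 0 \<le> p a \<and> p a \<le> 1"
  shows "measure_pmf.expectation (bits A p) (\<lambda>b. (r::real) + (\<Sum>a\<in>A. of_bool (b a) * u a))
    = r + (\<Sum>a\<in>A. p a * u a)"
  using assms
proof (induction A arbitrary: r rule: finite_induct)
  case (insert a A)
  define s where "s b = (\<Sum>t\<in>A. of_bool (b t) * u t)" for b
  have sum: "(\<Sum>t\<in>insert a A. of_bool ((b(a := v)) t) * u t) = of_bool v * u a + s b" for b v
  proof -
    have "(\<Sum>t\<in>A. of_bool ((b(a := v)) t) * u t) = s b"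
      unfolding s_def using insert.hyps by (intro sum.cong) auto
    then show ?thesis using insert.hyps by (simp only: sum.insert fun_upd_same if_True not_False_eq_True)
  qed
  have "measure_pmf.expectation (bits (insert a A) p)
      (\<lambda>b. r + (\<Sum>a\<in>insert a A. of_bool (b a) * u a))
    = measure_pmf.expectation (bits A p) (\<lambda>b. (r + p a * u a) + s b)"
    using insert.hyps insert.prems
    by (subst expectation_bits_insert) (simp_all only: sum, simp_all add: algebra_simps)
  then have "measure_pmf.expectation (bits (insert a A) p)
      (\<lambda>b. r + (\<Sum>a\<in>insert a A. of_bool (b a) * u a)) = (r + p a * u a) + (\<Sum>a\<in>A. p a * u a)"
    using insert.prems unfolding s_def by (subst (asm) insert.IH) auto
  then show ?case using insert by (simp add: algebra_simps)
qed (simp add: bits_def)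

text \<open>Second moment equals squared mean plus variance, and independence leaves only diagonal
  terms in the variance. The offset \<open>r\<close> is arbitrary so that the induction can absorb
  the mean \<open>p a *\<^sub>R v a\<close> of the added bit.\<close>

lemma expectation_norm2_bits:
  fixes v :: "'a \<Rightarrow> 'b::real_inner"
  assumes "finite A" "\<And>a. a \<in> A \<Longrightarrow> 0 \<le> p a \<and> p a \<le> 1"
  shows "measure_pmf.expectation (bits A p) (\<lambda>b. (norm (r + (\<Sum>a\<in>A. of_bool (b a) *\<^sub>R v a)))\<^sup>2)
    = (norm (r + (\<Sum>a\<in>A. p a *\<^sub>R v a)))\<^sup>2 + (\<Sum>a\<in>A. p a * (1 - p a) * (norm (v a))\<^sup>2)"
  using assms
proof (induction A arbitrary: r rule: finite_induct)
  case (insert a A)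
  define s where "s b = r + (\<Sum>t\<in>A. of_bool (b t) *\<^sub>R v t)" for b
  have sum: "r + (\<Sum>t\<in>insert a A. of_bool ((b(a := q)) t) *\<^sub>R v t) = s b + of_bool q *\<^sub>R v a" for b q
  proof -
    have "(\<Sum>t\<in>A. of_bool ((b(a := q)) t) *\<^sub>R v t) = (\<Sum>t\<in>A. of_bool (b t) *\<^sub>R v t)"
      using insert.hyps by (intro sum.cong) auto
    then show ?thesis using insert.hyps
      by (simp only: s_def sum.insert fun_upd_same if_True not_False_eq_True add_ac)
  qed
  have eq: "p a * (norm (w + v a))\<^sup>2 + (1 - p a) * (norm w)\<^sup>2
    = (norm (w + p a *\<^sub>R v a))\<^sup>2 + p a * (1 - p a) * (norm (v a))\<^sup>2" for w
    by (simp add: power2_norm_eq_inner inner_add_left inner_add_right inner_commute[of "v a" w] algebra_simps)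
  have "measure_pmf.expectation (bits (insert a A) p)
      (\<lambda>b. (norm (r + (\<Sum>a\<in>insert a A. of_bool (b a) *\<^sub>R v a)))\<^sup>2)
    = measure_pmf.expectation (bits A p) (\<lambda>b. p a * (norm (s b + v a))\<^sup>2 + (1 - p a) * (norm (s b))\<^sup>2)"
    using insert.hyps insert.prems
    by (subst expectation_bits_insert) (simp_all only: sum, simp_all)
  also have "\<dots> = measure_pmf.expectation (bits A p)
      (\<lambda>b. (norm ((r + p a *\<^sub>R v a) + (\<Sum>t\<in>A. of_bool (b t) *\<^sub>R v t)))\<^sup>2) + p a * (1 - p a) * (norm (v a))\<^sup>2"
    unfolding eq using insert.hyps by (simp add: integrable_bits s_def add_ac)
  also have "\<dots> = (norm ((r + p a *\<^sub>R v a) + (\<Sum>a\<in>A. p a *\<^sub>R v a)))\<^sup>2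
      + (\<Sum>a\<in>A. p a * (1 - p a) * (norm (v a))\<^sup>2) + p a * (1 - p a) * (norm (v a))\<^sup>2"
    using insert.prems by (subst insert.IH) auto
  finally show ?case using insert.hyps by (simp add: add_ac)
qed (simp add: bits_def)

text \<open>Extension by zero: it rewrites a sum over the agents of one sample as a sum over all
  bits of the block.\<close>

lemma sum_reindex_extend:
  fixes F :: "'a \<Rightarrow> 'b \<Rightarrow> 'c::comm_monoid_add"
  assumes "finite A" "inj h" "range h \<subseteq> A"
    and "\<And>a. a \<in> A \<Longrightarrow> a \<notin> range h \<Longrightarrow> G a = 0" "\<And>i. G (h i) = F' i"
  shows "(\<Sum>a\<in>A. G a) = (\<Sum>i\<in>UNIV. F' i :: 'c)"
proof -
  have "(\<Sum>a\<in>A. G a) = (\<Sum>a\<in>range h. G a)"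
    using assms by (intro sum.mono_neutral_right) auto
  then show ?thesis using assms by (simp add: sum.reindex)
qed

text \<open>A candidate uses only the bits \<open>h i\<close> of its own sample, while the law
  \<open>bits A p\<close> covers the whole block. Giving the other bits coefficient 0 reduces to the
  two lemmas on full families.\<close>

lemma
  fixes h :: "'n::finite \<Rightarrow> 'a" and u :: "'n \<Rightarrow> real" and v :: "'n \<Rightarrow> 'b::real_inner"
  assumes A: "finite A" "\<And>a. a \<in> A \<Longrightarrow> 0 \<le> p a \<and> p a \<le> 1"
    and h: "inj h" "range h \<subseteq> A" "\<And>i. p (h i) = \<omega>"
  shows expectation_linear_subfamily:
      "measure_pmf.expectation (bits A p) (\<lambda>b. \<Sum>i\<in>UNIV. of_bool (b (h i)) * u i) = \<omega> * (\<Sum>i\<in>UNIV. u i)"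
    and expectation_norm2_subfamily:
      "measure_pmf.expectation (bits A p) (\<lambda>b. (norm (\<Sum>i\<in>UNIV. of_bool (b (h i)) *\<^sub>R v i))\<^sup>2)
        = \<omega>\<^sup>2 * (norm (\<Sum>i\<in>UNIV. v i))\<^sup>2 + \<omega> * (1 - \<omega>) * (\<Sum>i\<in>UNIV. (norm (v i))\<^sup>2)"
proof -
  define u' v' where "u' a = (if a \<in> range h then u (inv h a) else 0)"
    and "v' a = (if a \<in> range h then v (inv h a) else 0)" for a
  note re = sum_reindex_extend[OF A(1) h(1,2)]
  have "(\<Sum>i\<in>UNIV. of_bool (b (h i)) * u i) = (\<Sum>a\<in>A. of_bool (b a) * u' a)" for b
    using h by (intro re[symmetric]) (auto simp: u'_def)
  moreover have "(\<Sum>a\<in>A. p a * u' a) = (\<Sum>i\<in>UNIV. \<omega> * u i)"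
    using h by (intro re) (auto simp: u'_def)
  ultimately show "measure_pmf.expectation (bits A p) (\<lambda>b. \<Sum>i\<in>UNIV. of_bool (b (h i)) * u i) = \<omega> * (\<Sum>i\<in>UNIV. u i)"
    by (simp only: expectation_affine_bits[OF A, where r = 0, unfolded add_0_left] sum_distrib_left)
  have "(\<Sum>i\<in>UNIV. of_bool (b (h i)) *\<^sub>R v i) = (\<Sum>a\<in>A. of_bool (b a) *\<^sub>R v' a)" for b
    using h by (intro re[symmetric]) (auto simp: v'_def)
  moreover have "(\<Sum>a\<in>A. p a *\<^sub>R v' a) = (\<Sum>i\<in>UNIV. \<omega> *\<^sub>R v i)"
    using h by (intro re) (auto simp: v'_def)
  moreover have "(\<Sum>a\<in>A. p a * (1 - p a) * (norm (v' a))\<^sup>2) = (\<Sum>i\<in>UNIV. \<omega> * (1 - \<omega>) * (norm (v i))\<^sup>2)"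
    using h by (intro re) (auto simp: v'_def)
  ultimately show "measure_pmf.expectation (bits A p) (\<lambda>b. (norm (\<Sum>i\<in>UNIV. of_bool (b (h i)) *\<^sub>R v i))\<^sup>2)
        = \<omega>\<^sup>2 * (norm (\<Sum>i\<in>UNIV. v i))\<^sup>2 + \<omega> * (1 - \<omega>) * (\<Sum>i\<in>UNIV. (norm (v i))\<^sup>2)"
    by (simp only: expectation_norm2_bits[OF A, where r = 0, unfolded add_0_left])
      (simp add: scaleR_right.sum[symmetric] sum_distrib_left power_mult_distrib)
qed

subsection \<open>Gradients on subspaces\<close>

text \<open>The line stays in \<open>V\<close>, so a derivative relative to \<open>V\<close> yields
  a two-sided derivative in the real parameter, and one-variable calculus applies.\<close>

lemma has_gradient_line:
  assumes "subspace V" "y \<in> V" "d \<in> V" "has_gradient V F v (y + t *\<^sub>R d)"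
  shows "((\<lambda>t. F (y + t *\<^sub>R d)) has_real_derivative (v \<bullet> d)) (at t)"
proof -
  have "((\<lambda>t. y + t *\<^sub>R d) has_derivative (\<lambda>h. h *\<^sub>R d)) (at t)"
    by (auto intro!: derivative_eq_intros)
  moreover have "(F has_derivative (\<lambda>h. v \<bullet> h)) (at (y + t *\<^sub>R d) within range (\<lambda>t. y + t *\<^sub>R d))"
    using assms unfolding has_gradient_def
    by (auto intro!: has_derivative_subset[of F _ _ V] subspace_add subspace_scale)
  ultimately have "((\<lambda>t. F (y + t *\<^sub>R d)) has_derivative (\<lambda>h. v \<bullet> (h *\<^sub>R d))) (at t)"
    by (rule has_derivative_in_compose)
  then show ?thesis by (simp add: has_field_derivative_def mult.commute[of _ "v \<bullet> d"])
qed

text \<open>Two gradients lie in \<open>V\<close>, hence so does their difference; differentiating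
  along that direction shows it to be orthogonal to itself.\<close>

lemma gradient_eq:
  assumes "subspace V" "y \<in> V" "has_gradient V F v y"
  shows "gradient V F y = v"
  unfolding gradient_def
proof (rule the_equality)
  fix v' assume v': "has_gradient V F v' y"
  have V: "v \<in> V" "v' \<in> V" using assms v' by (auto simp: has_gradient_def)
  then have d: "v - v' \<in> V" using assms by (simp add: subspace_diff)
  have "v \<bullet> (v - v') = v' \<bullet> (v - v')"
    using has_gradient_line[of V y "v - v'" F v 0] has_gradient_line[of V y "v - v'" F v' 0] assms v' d
    by (intro DERIV_unique) auto
  then have "(v - v') \<bullet> (v - v') = 0" by (simp add: inner_diff_left)
  then show "v' = v" by simp
qed fact

lemma has_gradient_gradient:
  assumes "subspace V" "y \<in> V" "has_gradient V F v y"
  shows "has_gradient V F (gradient V F y) y"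
  using gradient_eq[OF assms] assms by simp

lemma segment_in_convex:
  assumes "convex C" "y \<in> C" "z \<in> C" "0 \<le> t" "t \<le> (1::real)"
  shows "y + t *\<^sub>R (z - y) \<in> C"
proof -
  have "(1 - t) *\<^sub>R y + t *\<^sub>R z \<in> C" using assms by (intro convexD) auto
  then show ?thesis by (simp add: algebra_simps)
qed

context
  fixes V C :: "'a::real_inner set" and F :: "'a \<Rightarrow> real"
  assumes V: "subspace V" and C: "convex C" "C \<subseteq> V"
    and grad: "\<And>y. y \<in> C \<Longrightarrow> has_gradient V F (gradient V F y) y"
begin

lemma derivative_segment:
  assumes "y \<in> C" "z \<in> C" "0 \<le> t" "t \<le> 1"
  shows "((\<lambda>t. F (y + t *\<^sub>R (z - y))) has_real_derivative
    (gradient V F (y + t *\<^sub>R (z - y)) \<bullet> (z - y))) (at t)"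
  using assms V C by (intro has_gradient_line[of V] grad segment_in_convex)
    (auto intro: subspace_diff)

text \<open>Along the segment, the value minus its quadratic upper model has derivative at most 0,
  by Cauchy-Schwarz and the Lipschitz bound on the gradient.\<close>

lemma descent_inequality:
  assumes Lip: "lipschitz_on l C (gradient V F)" and yz: "y \<in> C" "z \<in> C"
  shows "F z \<le> F y + gradient V F y \<bullet> (z - y) + l / 2 * (norm (z - y))\<^sup>2"
proof -
  define d where "d = z - y"
  define \<phi> where "\<phi> t = F (y + t *\<^sub>R d) - t * (gradient V F y \<bullet> d) - l / 2 * t\<^sup>2 * (norm d)\<^sup>2" for t
  have "\<phi> 1 \<le> \<phi> 0"
  proof (rule DERIV_nonpos_imp_nonincreasing[of 0 1 \<phi>])
    fix t :: real assume t: "0 \<le> t" "t \<le> 1"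
    have in_C: "y + t *\<^sub>R d \<in> C" unfolding d_def using C yz t by (intro segment_in_convex)
    have "(\<phi> has_real_derivative
        (gradient V F (y + t *\<^sub>R d) \<bullet> d - gradient V F y \<bullet> d - l * t * (norm d)\<^sup>2)) (at t)"
      unfolding \<phi>_def using derivative_segment[OF yz t]
      by (auto simp: d_def intro!: derivative_eq_intros)
    moreover have "gradient V F (y + t *\<^sub>R d) \<bullet> d - gradient V F y \<bullet> d - l * t * (norm d)\<^sup>2 \<le> 0"
    proof -
      have "(gradient V F (y + t *\<^sub>R d) - gradient V F y) \<bullet> d
        \<le> norm (gradient V F (y + t *\<^sub>R d) - gradient V F y) * norm d"
        by (rule norm_cauchy_schwarz)
      also have "\<dots> \<le> (l * norm (t *\<^sub>R d)) * norm d"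
        using lipschitz_onD[OF Lip in_C yz(1)] by (intro mult_right_mono) (auto simp: dist_norm)
      finally show ?thesis using t by (simp add: inner_diff_left power2_eq_square)
    qed
    ultimately show "\<exists>D. (\<phi> has_real_derivative D) (at t) \<and> D \<le> 0" by blast
  qed simp
  then show ?thesis by (simp add: \<phi>_def d_def)
qed

text \<open>For 0 < t < 1 the difference quotients are at most the slope of the full chord; the
  one-sided limit at 0 inherits the bound.\<close>

lemma convex_above_tangent:
  assumes conv: "convex_on C F" and yz: "y \<in> C" "z \<in> C"
  shows "F y + gradient V F y \<bullet> (z - y) \<le> F z"
proof -
  have "((\<lambda>t. (F (y + t *\<^sub>R (z - y)) - F y) / t) \<longlongrightarrow> gradient V F y \<bullet> (z - y)) (at 0)"
    using derivative_segment[OF yz, of 0] by (simp add: DERIV_def)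
  then have "((\<lambda>t. (F (y + t *\<^sub>R (z - y)) - F y) / t) \<longlongrightarrow> gradient V F y \<bullet> (z - y)) (at_right 0)"
    by (rule filterlim_mono) (auto simp: at_within_le_at)
  moreover have "\<forall>\<^sub>F t in at_right 0. (F (y + t *\<^sub>R (z - y)) - F y) / t \<le> F z - F y"
    unfolding eventually_at_right_field
  proof (intro exI[of _ 1] conjI allI impI)
    fix t :: real assume t: "0 < t" "t < 1"
    have "F ((1 - t) *\<^sub>R y + t *\<^sub>R z) \<le> (1 - t) * F y + t * F z"
      using convex_onD[OF conv, of t y z] t yz by auto
    then have "F (y + t *\<^sub>R (z - y)) - F y \<le> (F z - F y) * t" by (simp add: algebra_simps)
    then show "(F (y + t *\<^sub>R (z - y)) - F y) / t \<le> F z - F y"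
      using t by (simp add: pos_divide_le_eq)
  qed simp
  ultimately have "gradient V F y \<bullet> (z - y) \<le> F z - F y"
    by (rule tendsto_upperbound) simp
  then show ?thesis by simp
qed

end

lemma subspace_obs_space:
  "(\<And>j. subspace (E j)) \<Longrightarrow> subspace (obs_space E)"
  by (simp add: subspace_def obs_space_def)

text \<open>Links the two uses of gradients: the regularity hypotheses concern each
  \<open>f j\<close> on \<open>E j\<close>, whereas the algorithm takes the gradient of the sum on
  the product space.\<close>

lemma has_gradient_social:
  assumes "\<And>j. has_gradient (E j) (f j) (v $ j) (y $ j)"
  shows "has_gradient (obs_space E) (social f) v y"
  unfolding has_gradient_def
proof
  show "v \<in> obs_space E" using assms by (simp add: has_gradient_def obs_space_def)
  have "((\<lambda>y. f j (y $ j)) has_derivative (\<lambda>h. v $ j \<bullet> (h $ j))) (at y within obs_space E)" for j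
  proof (rule has_derivative_in_compose[where f = "\<lambda>y. y $ j" and g = "f j"])
    show "((\<lambda>y. y $ j) has_derivative (\<lambda>h. h $ j)) (at y within obs_space E)"
      by (intro bounded_linear_imp_has_derivative bounded_linear_vec_nth)
    show "(f j has_derivative (\<bullet>) (v $ j)) (at (y $ j) within (\<lambda>y. y $ j) ` obs_space E)"
      using assms by (auto simp: has_gradient_def obs_space_def intro: has_derivative_subset)
  qed
  then have "((\<lambda>y. \<Sum>j\<in>UNIV. f j (y $ j)) has_derivative (\<lambda>h. \<Sum>j\<in>UNIV. v $ j \<bullet> (h $ j)))
      (at y within obs_space E)"
    by (intro has_derivative_sum)
  then show "(social f has_derivative (\<bullet>) v) (at y within obs_space E)"
    by (simp add: social_def[abs_def] inner_vec_def[abs_def])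
qed

lemma sum_in_set_sum:
  assumes "finite I" "\<And>i. i \<in> I \<Longrightarrow> s i \<in> T i"
  shows "sum s I \<in> sum T I"
  using assms by (auto simp: set_sum_alt)

section \<open>Deterministic properties of the aggregative problem\<close>

locale frank_wolfe =
  fixes X :: "'n::finite \<Rightarrow> 'x set"
    and E :: "'m::finite \<Rightarrow> 'e::{real_inner, banach, second_countable_topology} set"
    and f :: "'m \<Rightarrow> 'e \<Rightarrow> real"
    and g :: "'n \<Rightarrow> 'm \<Rightarrow> 'x \<Rightarrow> 'e"
    and L L' :: "'m \<Rightarrow> real"
    and S :: "'n \<Rightarrow> 'e ^ 'm \<Rightarrow> 'x"
  assumes data: "problem_data X E g"
    and A1: "assumption1 X E f g L L'"
    and A2: "assumption2 X f g"
    and A3: "assumption3 X E f g S"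
begin

abbreviation conv_range :: "'m \<Rightarrow> 'e set" where
  "conv_range j \<equiv> convex hull (range_j X g j)"

definition price :: "('n \<Rightarrow> 'x) \<Rightarrow> 'e ^ 'm" where
  "price z = gradient (obs_space E) (social f) (agg g z)"

definition best :: "('n \<Rightarrow> 'x) \<Rightarrow> 'n \<Rightarrow> 'x" where
  "best z i = S i (price z)"

lemma candidate_eq: "sfw_candidate E f g S z b = (\<lambda>i. if b i then best z i else z i)"
  by (simp add: fun_eq_iff sfw_candidate_def best_def price_def)

lemma subspace_E: "subspace (E j)" and g_in_E: "a \<in> X i \<Longrightarrow> g i j a \<in> E j"
  using data by (auto simp: problem_data_def Pi_iff)

lemma agg_nth: "agg g z $ j = (1 / real CARD('n)) *\<^sub>R (\<Sum>i\<in>UNIV. g i j (z i))"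
  by (simp add: agg_def contrib_def)

lemma agg_in_range: "z \<in> dec_space X \<Longrightarrow> agg g z $ j \<in> range_j X g j"
  unfolding agg_nth range_j_def
  by (intro imageI sum_in_set_sum) (auto simp: dec_space_def range_ij_def)

lemma agg_in_conv: "z \<in> dec_space X \<Longrightarrow> agg g z $ j \<in> conv_range j"
  by (intro hull_inc agg_in_range)

lemma conv_range_subset: "conv_range j \<subseteq> E j"
proof (rule hull_minimal)
  show "range_j X g j \<subseteq> E j"
    unfolding range_j_def range_ij_def
    by (auto simp: set_sum_alt intro!: subspace_scale subspace_sum subspace_E)
      (metis g_in_E imageE)
  show "convex (E j)" by (intro subspace_imp_convex subspace_E)
qed

lemma gradient_on_conv:
  assumes "y \<in> conv_range j"
  shows "has_gradient (E j) (f j) (gradient (E j) (f j) y) y"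
proof -
  obtain v where "has_gradient (E j) (f j) v y"
    using A1 assms unfolding assumption1_def C1_near_def by blast
  then show ?thesis
    using assms conv_range_subset by (intro has_gradient_gradient subspace_E) auto
qed

lemma Lipschitz: "lipschitz_on (L j) (conv_range j) (f j)"
  and Lipschitz_gradient: "lipschitz_on (L' j) (conv_range j) (gradient (E j) (f j))"
  and bounded_range: "bounded (range_ij X g i j)"
  using A1 by (auto simp: assumption1_def)

lemma social_gradient:
  assumes "\<And>j. y $ j \<in> conv_range j"
  shows "gradient (obs_space E) (social f) y = (\<chi> j. gradient (E j) (f j) (y $ j))"
  using assms conv_range_subset
  by (intro gradient_eq subspace_obs_space subspace_E has_gradient_social)
    (auto simp: obs_space_def gradient_on_conv)

lemma price_nth: "z \<in> dec_space X \<Longrightarrow> price z $ j = gradient (E j) (f j) (agg g z $ j)"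
  by (simp add: price_def social_gradient agg_in_conv)

lemma best_response:
  assumes "z \<in> dec_space X"
  shows "best z i \<in> X i" and "a \<in> X i \<Longrightarrow> price z \<bullet> contrib g i (best z i) \<le> price z \<bullet> contrib g i a"
proof -
  have "price z \<in> price_set X E f g"
    unfolding price_set_def price_def using assms by (intro imageI hull_inc)
  then have "is_arg_min (\<lambda>a. price z \<bullet> contrib g i a) (\<lambda>a. a \<in> X i) (best z i)"
    using A3 by (simp add: assumption3_def best_def)
  then show "best z i \<in> X i" "a \<in> X i \<Longrightarrow> price z \<bullet> contrib g i (best z i) \<le> price z \<bullet> contrib g i a"
    by (auto simp: is_arg_min_def not_less)
qed

lemma candidate_in_dec_space: "z \<in> dec_space X \<Longrightarrow> sfw_candidate E f g S z b \<in> dec_space X"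
  using best_response(1)[of z] by (auto simp: candidate_eq dec_space_def)

lemma diam_bound: "a \<in> X i \<Longrightarrow> a' \<in> X i \<Longrightarrow> norm (g i j a - g i j a') \<le> diam X g i j"
  unfolding diam_def dist_norm[symmetric]
  by (intro diameter_bounded_bound bounded_range) (auto simp: range_ij_def)

subsection \<open>The duality gap\<close>

lemma mean_in_hull:
  assumes "\<mu> \<in> fin_supp_measures X"
  shows "mean_contrib g i (\<mu> i) $ j \<in> convex hull (range_ij X g i j)"
proof -
  have fin: "finite (set_pmf (\<mu> i))" and sub: "set_pmf (\<mu> i) \<subseteq> X i"
    using assms by (auto simp: fin_supp_measures_def)
  have "mean_contrib g i (\<mu> i) $ j = (\<Sum>a\<in>set_pmf (\<mu> i). pmf (\<mu> i) a *\<^sub>R g i j a)"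
    unfolding mean_contrib_def using fin
    by (simp, subst integral_measure_pmf[of "set_pmf (\<mu> i)"]) (auto simp: set_pmf_iff)
  also have "\<dots> \<in> convex hull (range_ij X g i j)"
    using fin sub by (intro convex_sum) (auto simp: sum_pmf_eq_1 range_ij_def intro!: hull_inc)
  finally show ?thesis .
qed

definition mean_agg :: "('n \<Rightarrow> 'x pmf) \<Rightarrow> 'e ^ 'm" where
  "mean_agg \<mu> = (1 / real CARD('n)) *\<^sub>R (\<Sum>i\<in>UNIV. mean_contrib g i (\<mu> i))"

text \<open>Convex hulls commute with scaling and with Minkowski sums, so expected aggregates stay
  in the set where the hypotheses on \<open>f j\<close> hold.\<close>

lemma mean_agg_in_conv:
  assumes "\<mu> \<in> fin_supp_measures X"
  shows "mean_agg \<mu> $ j \<in> conv_range j"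
proof -
  have "(\<Sum>i\<in>UNIV. mean_contrib g i (\<mu> i) $ j) \<in> (\<Sum>i\<in>UNIV. convex hull (range_ij X g i j))"
    using assms by (intro sum_in_set_sum mean_in_hull) auto
  then show ?thesis
    by (simp add: mean_agg_def range_j_def convex_hull_scaling convex_hull_set_sum)
qed

text \<open>At a fixed price the linearized problem decouples over the agents, and a mean over a
  randomized strategy cannot be below the minimum attained by \<open>best\<close>.\<close>

lemma price_mean:
  assumes "z \<in> dec_space X" "\<mu> \<in> fin_supp_measures X"
  shows "price z \<bullet> agg g (best z) \<le> price z \<bullet> mean_agg \<mu>"
proof -
  have "price z \<bullet> contrib g i (best z i) \<le> price z \<bullet> mean_contrib g i (\<mu> i)" for i
  proof -
    have fin: "finite (set_pmf (\<mu> i))" and sub: "set_pmf (\<mu> i) \<subseteq> X i"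
      using assms by (auto simp: fin_supp_measures_def)
    have int: "integrable (measure_pmf (\<mu> i)) H" for H :: "'x \<Rightarrow> 'b::{banach, second_countable_topology}"
      using fin by (rule integrable_measure_pmf_finite)
    have "price z \<bullet> contrib g i (best z i) = measure_pmf.expectation (\<mu> i) (\<lambda>a. price z \<bullet> contrib g i (best z i))"
      by simp
    also have "\<dots> \<le> measure_pmf.expectation (\<mu> i) (\<lambda>a. price z \<bullet> contrib g i a)"
      using sub by (intro integral_mono_AE int) (auto simp: AE_measure_pmf_iff intro!: best_response assms)
    also have "\<dots> = price z \<bullet> mean_contrib g i (\<mu> i)"
      by (simp add: inner_vec_def contrib_def mean_contrib_def int integral_sum)
    finally show ?thesis .
  qed
  then show ?thesis
    by (simp add: agg_def mean_agg_def inner_sum_right sum_mono divide_right_mono)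
qed

text \<open>The tangent of \<open>social f\<close> at \<open>agg g z\<close> lies below it, and
  \<open>best z\<close> minimizes this tangent even over randomized strategies. This is the
  Frank-Wolfe lower bound on the optimal value.\<close>

lemma rcost_lower_bound:
  assumes z: "z \<in> dec_space X" and \<mu>: "\<mu> \<in> fin_supp_measures X"
  shows "cost f g z + price z \<bullet> (agg g (best z) - agg g z) \<le> rcost f g \<mu>"
proof -
  have "cost f g z + price z \<bullet> (mean_agg \<mu> - agg g z)
    = (\<Sum>j\<in>UNIV. f j (agg g z $ j) + gradient (E j) (f j) (agg g z $ j) \<bullet> (mean_agg \<mu> $ j - agg g z $ j))"
    by (simp add: cost_def social_def inner_vec_def price_nth z sum.distrib)
  also have "\<dots> \<le> (\<Sum>j\<in>UNIV. f j (mean_agg \<mu> $ j))"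
    using A2 by (intro sum_mono convex_above_tangent[OF subspace_E convex_convex_hull conv_range_subset gradient_on_conv]
      agg_in_conv mean_agg_in_conv z \<mu>) (auto simp: assumption2_def)
  also have "\<dots> = rcost f g \<mu>" by (simp add: rcost_def social_def mean_agg_def)
  finally show ?thesis using price_mean[OF z \<mu>] by (simp add: inner_diff_right)
qed

lemma Dirac:
  assumes "z \<in> dec_space X"
  shows "(\<lambda>i. return_pmf (z i)) \<in> fin_supp_measures X" "rcost f g (\<lambda>i. return_pmf (z i)) = cost f g z"
  using assms
  by (auto simp: fin_supp_measures_def dec_space_def rcost_def cost_def mean_contrib_def agg_def contrib_def)

text \<open>Nonnegativity comes from embedding \<open>z\<close> as a product of Dirac measures, the
  upper bound from \<open>rcost_lower_bound\<close>. The latter also gives the lower boundedness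
  without which a real infimum would say nothing.\<close>

lemma gap_bounds:
  assumes z: "z \<in> dec_space X"
  shows "0 \<le> gap X f g z" "gap X f g z \<le> price z \<bullet> (agg g z - agg g (best z))"
proof -
  have "bdd_below (rcost f g ` fin_supp_measures X)"
    using rcost_lower_bound[OF z] by (rule bdd_belowI2)
  then have "rcost_inf X f g \<le> rcost f g (\<lambda>i. return_pmf (z i))"
    unfolding rcost_inf_def using Dirac[OF z] by (intro cINF_lower) auto
  then show "0 \<le> gap X f g z" using Dirac[OF z] by (simp add: gap_def)
  have "cost f g z + price z \<bullet> (agg g (best z) - agg g z) \<le> rcost_inf X f g"
    unfolding rcost_inf_def using Dirac[OF z] rcost_lower_bound[OF z] by (intro cINF_greatest) auto
  then show "gap X f g z \<le> price z \<bullet> (agg g z - agg g (best z))"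
    by (simp add: gap_def inner_diff_right)
qed

subsection \<open>One step of the algorithm\<close>

text \<open>One agent has weight 1/N in the aggregate, so a change of its decision moves block j by
  at most the largest diameter over N. This is the origin of \<open>C0\<close>.\<close>

lemma cost_difference:
  assumes "z \<in> dec_space X" "a \<in> X i"
  shows "\<bar>cost f g (z(i := a)) - cost f g z\<bar> \<le> C0 X g L / real CARD('n)"
proof -
  have z': "z(i := a) \<in> dec_space X" using assms by (auto simp: dec_space_def)
  have zi: "z i \<in> X i" using assms by (auto simp: dec_space_def)
  have L: "0 \<le> L j" for j using Lipschitz by (rule lipschitz_on_nonneg)
  have "\<bar>cost f g (z(i := a)) - cost f g z\<bar>
    = \<bar>\<Sum>j\<in>UNIV. f j (agg g (z(i := a)) $ j) - f j (agg g z $ j)\<bar>"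
    by (simp add: cost_def social_def sum_subtractf)
  also have "\<dots> \<le> (\<Sum>j\<in>UNIV. \<bar>f j (agg g (z(i := a)) $ j) - f j (agg g z $ j)\<bar>)" by (rule sum_abs)
  also have "\<dots> \<le> (\<Sum>j\<in>UNIV. L j * (Max (range (\<lambda>i. diam X g i j)) / real CARD('n)))"
  proof (rule sum_mono)
    fix j
    have "(\<Sum>k\<in>UNIV. g k j ((z(i := a)) k)) - (\<Sum>k\<in>UNIV. g k j (z k)) = g i j a - g i j (z i)"
      unfolding sum_subtractf[symmetric] by (subst sum.remove[of _ i]) (auto intro!: sum.neutral)
    then have "agg g (z(i := a)) $ j - agg g z $ j = (1 / real CARD('n)) *\<^sub>R (g i j a - g i j (z i))"
      by (simp only: agg_nth scaleR_diff_right[symmetric])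
    then have "norm (agg g (z(i := a)) $ j - agg g z $ j) = norm (g i j a - g i j (z i)) / real CARD('n)" by simp
    also have "\<dots> \<le> Max (range (\<lambda>i. diam X g i j)) / real CARD('n)"
      by (intro divide_right_mono order_trans[OF diam_bound[OF assms(2) zi]] Max_ge) auto
    finally have d: "norm (agg g (z(i := a)) $ j - agg g z $ j) \<le> Max (range (\<lambda>i. diam X g i j)) / real CARD('n)" .
    have "\<bar>f j (agg g (z(i := a)) $ j) - f j (agg g z $ j)\<bar> \<le> L j * norm (agg g (z(i := a)) $ j - agg g z $ j)"
      using lipschitz_onD[OF Lipschitz agg_in_conv[OF z'] agg_in_conv[OF assms(1)]] by (simp add: dist_norm)
    also have "\<dots> \<le> L j * (Max (range (\<lambda>i. diam X g i j)) / real CARD('n))" by (intro mult_left_mono d L)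
    finally show "\<bar>f j (agg g (z(i := a)) $ j) - f j (agg g z $ j)\<bar> \<le> L j * (Max (range (\<lambda>i. diam X g i j)) / real CARD('n))" .
  qed
  also have "\<dots> = C0 X g L / real CARD('n)" by (simp add: C0_def sum_divide_distrib)
  finally show ?thesis .
qed

lemma candidate_difference:
  assumes "z \<in> dec_space X"
  shows "\<bar>cost f g (sfw_candidate E f g S z (b(i := True))) - cost f g (sfw_candidate E f g S z (b(i := False)))\<bar>
    \<le> C0 X g L / real CARD('n)"
proof -
  have "sfw_candidate E f g S z (b(i := True)) = (sfw_candidate E f g S z (b(i := False)))(i := best z i)"
    by (auto simp: candidate_eq)
  then show ?thesis
    by (simp only:) (intro cost_difference candidate_in_dec_space best_response assms)
qed

text \<open>In the descent inequality at \<open>z\<close> the expected linear term is \<omega> times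
  the linearized decrease. The quadratic term splits into squared mean, of order \<omega>^2, and
  variance, which carries an extra 1/N by independence of the agents.\<close>

lemma expected_candidate:
  fixes h :: "'n \<Rightarrow> 'a"
  assumes A: "finite A" "\<And>a. a \<in> A \<Longrightarrow> 0 \<le> p a \<and> p a \<le> 1"
    and h: "inj h" "range h \<subseteq> A" "\<And>i. p (h i) = \<omega>"
    and z: "z \<in> dec_space X"
  shows "measure_pmf.expectation (bits A p) (\<lambda>b. cost f g (sfw_candidate E f g S z (\<lambda>i. b (h i))))
    \<le> cost f g z + \<omega> * (price z \<bullet> (agg g (best z) - agg g z))
      + C1 X g L' / 2 * (\<omega>\<^sup>2 + \<omega> * (1 - \<omega>) / real CARD('n))"
proof -
  define v where "v i = contrib g i (best z i) - contrib g i (z i)" for i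
  define q where "q b j = (norm (\<Sum>i\<in>UNIV. of_bool (b (h i)) *\<^sub>R (v i $ j)))\<^sup>2" for b j
  define l where "l b = (\<Sum>i\<in>UNIV. of_bool (b (h i)) * (price z \<bullet> v i / real CARD('n)))" for b
  have \<omega>: "0 \<le> \<omega>" "\<omega> \<le> 1" using A(2) h(2,3) by (metis range_subsetD)+
  have L': "0 \<le> L' j" for j using Lipschitz_gradient by (rule lipschitz_on_nonneg)
  have pointwise: "cost f g (sfw_candidate E f g S z (\<lambda>i. b (h i)))
    \<le> cost f g z + l b + (\<Sum>j\<in>UNIV. L' j / (2 * (real CARD('n))\<^sup>2) * q b j)" for b
  proof -
    let ?c = "sfw_candidate E f g S z (\<lambda>i. b (h i))"
    have "contrib g i (?c i) = contrib g i (z i) + of_bool (b (h i)) *\<^sub>R v i" for i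
      by (simp add: candidate_eq v_def)
    then have d: "agg g ?c - agg g z = (1 / real CARD('n)) *\<^sub>R (\<Sum>i\<in>UNIV. of_bool (b (h i)) *\<^sub>R v i)"
      by (simp add: agg_def sum.distrib scaleR_add_right)
    then have dj: "agg g ?c $ j - agg g z $ j = (1 / real CARD('n)) *\<^sub>R (\<Sum>i\<in>UNIV. of_bool (b (h i)) *\<^sub>R (v i $ j))" for j
      unfolding vector_minus_component[symmetric] d by simp
    have "cost f g ?c \<le> (\<Sum>j\<in>UNIV. f j (agg g z $ j)
        + gradient (E j) (f j) (agg g z $ j) \<bullet> (agg g ?c $ j - agg g z $ j)
        + L' j / 2 * (norm (agg g ?c $ j - agg g z $ j))\<^sup>2)"
      unfolding cost_def social_def
      by (intro sum_mono descent_inequality[OF subspace_E convex_convex_hull conv_range_subset gradient_on_conv]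
        Lipschitz_gradient agg_in_conv candidate_in_dec_space z)
    also have "\<dots> = cost f g z + price z \<bullet> (agg g ?c - agg g z)
        + (\<Sum>j\<in>UNIV. L' j / 2 * (norm (agg g ?c $ j - agg g z $ j))\<^sup>2)"
      by (simp add: sum.distrib cost_def social_def inner_vec_def price_nth z)
    also have "price z \<bullet> (agg g ?c - agg g z) = l b"
      unfolding d l_def inner_scaleR_right inner_sum_right sum_distrib_left by (intro sum.cong) auto
    also have "(\<Sum>j\<in>UNIV. L' j / 2 * (norm (agg g ?c $ j - agg g z $ j))\<^sup>2)
      = (\<Sum>j\<in>UNIV. L' j / (2 * (real CARD('n))\<^sup>2) * q b j)"
      by (simp add: dj q_def power_divide field_simps)
    finally show ?thesis .
  qed
  have El: "measure_pmf.expectation (bits A p) l = \<omega> * (price z \<bullet> (agg g (best z) - agg g z))"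
  proof -
    have "(\<Sum>i\<in>UNIV. price z \<bullet> v i / real CARD('n)) = price z \<bullet> (agg g (best z) - agg g z)"
      by (simp add: v_def agg_def inner_diff_right inner_sum_right sum_subtractf sum_divide_distrib[symmetric] diff_divide_distrib)
    then show ?thesis
      unfolding l_def by (simp only: expectation_linear_subfamily[where p = p and h = h and \<omega> = \<omega>, OF A h])
  qed
  have Eq: "measure_pmf.expectation (bits A p) (\<lambda>b. q b j) \<le> (\<omega>\<^sup>2 * real CARD('n) + \<omega> * (1 - \<omega>)) * (\<Sum>i\<in>UNIV. (diam X g i j)\<^sup>2)" for j
  proof -
    let ?s = "\<Sum>i\<in>UNIV. (norm (v i $ j))\<^sup>2"
    have v: "norm (v i $ j) \<le> diam X g i j" for i
      using z by (auto simp: v_def contrib_def dec_space_def intro!: diam_bound best_response)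
    \<comment> \<open>Cauchy-Schwarz costs a factor N, which the 1/N^2 from averaging the agents
      reduces to the 1/N in \<open>C1\<close>.\<close>
    have "(norm (\<Sum>i\<in>UNIV. v i $ j))\<^sup>2 \<le> (\<Sum>i\<in>UNIV. norm (v i $ j))\<^sup>2"
      by (rule power_mono[OF norm_sum norm_ge_zero])
    also have "\<dots> \<le> ?s * real CARD('n)" by (rule sum_squared_le_sum_of_squares)
    finally have s: "(norm (\<Sum>i\<in>UNIV. v i $ j))\<^sup>2 \<le> ?s * real CARD('n)" .
    have "measure_pmf.expectation (bits A p) (\<lambda>b. q b j)
      = \<omega>\<^sup>2 * (norm (\<Sum>i\<in>UNIV. v i $ j))\<^sup>2 + \<omega> * (1 - \<omega>) * ?s"
      unfolding q_def by (rule expectation_norm2_subfamily[where p = p and h = h and \<omega> = \<omega>, OF A h])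
    also have "\<dots> \<le> \<omega>\<^sup>2 * (?s * real CARD('n)) + \<omega> * (1 - \<omega>) * ?s"
      by (intro add_right_mono mult_left_mono s) simp
    also have "\<dots> = (\<omega>\<^sup>2 * real CARD('n) + \<omega> * (1 - \<omega>)) * ?s" by (simp add: algebra_simps)
    also have "\<dots> \<le> (\<omega>\<^sup>2 * real CARD('n) + \<omega> * (1 - \<omega>)) * (\<Sum>i\<in>UNIV. (diam X g i j)\<^sup>2)"
      using \<omega> by (intro mult_left_mono sum_mono power_mono v) auto
    finally show ?thesis .
  qed
  note int = integrable_bits[OF A(1)]
  have "measure_pmf.expectation (bits A p) (\<lambda>b. cost f g (sfw_candidate E f g S z (\<lambda>i. b (h i))))
    \<le> measure_pmf.expectation (bits A p) (\<lambda>b. cost f g z + l b + (\<Sum>j\<in>UNIV. L' j / (2 * (real CARD('n))\<^sup>2) * q b j))"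
    by (intro expectation_bits_mono A pointwise)
  also have "\<dots> = cost f g z + measure_pmf.expectation (bits A p) l
      + (\<Sum>j\<in>UNIV. L' j / (2 * (real CARD('n))\<^sup>2) * measure_pmf.expectation (bits A p) (\<lambda>b. q b j))"
    by (simp add: int integral_sum)
  also have "\<dots> \<le> cost f g z + \<omega> * (price z \<bullet> (agg g (best z) - agg g z))
      + (\<Sum>j\<in>UNIV. L' j / (2 * (real CARD('n))\<^sup>2) * ((\<omega>\<^sup>2 * real CARD('n) + \<omega> * (1 - \<omega>)) * (\<Sum>i\<in>UNIV. (diam X g i j)\<^sup>2)))"
    unfolding El using L' by (intro add_left_mono sum_mono mult_left_mono Eq) auto
  also have "(\<Sum>j\<in>UNIV. L' j / (2 * (real CARD('n))\<^sup>2) * ((\<omega>\<^sup>2 * real CARD('n) + \<omega> * (1 - \<omega>)) * (\<Sum>i\<in>UNIV. (diam X g i j)\<^sup>2)))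
    = C1 X g L' / 2 * (\<omega>\<^sup>2 + \<omega> * (1 - \<omega>) / real CARD('n))"
  proof -
    have "(\<omega>\<^sup>2 * real CARD('n) + \<omega> * (1 - \<omega>)) / real CARD('n) = \<omega>\<^sup>2 + \<omega> * (1 - \<omega>) / real CARD('n)"
      by (simp add: field_simps)
    moreover have "(\<Sum>j\<in>UNIV. L' j / (2 * (real CARD('n))\<^sup>2) * ((\<omega>\<^sup>2 * real CARD('n) + \<omega> * (1 - \<omega>)) * (\<Sum>i\<in>UNIV. (diam X g i j)\<^sup>2)))
      = C1 X g L' / 2 * ((\<omega>\<^sup>2 * real CARD('n) + \<omega> * (1 - \<omega>)) / real CARD('n))"
      by (simp add: C1_def sum_distrib_left sum_distrib_right sum_divide_distrib power2_eq_square mult_ac)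
    ultimately show ?thesis by simp
  qed
  finally show ?thesis .
qed

end

section \<open>The iterates as functions of the bits\<close>

locale stochastic_frank_wolfe = frank_wolfe X E f g L L' S + prob_space \<Omega>
  for X :: "'n::finite \<Rightarrow> 'x set"
    and E :: "'m::finite \<Rightarrow> 'e::{real_inner, banach, second_countable_topology} set"
    and f :: "'m \<Rightarrow> 'e \<Rightarrow> real"
    and g :: "'n \<Rightarrow> 'm \<Rightarrow> 'x \<Rightarrow> 'e"
    and L L' :: "'m \<Rightarrow> real"
    and S :: "'n \<Rightarrow> 'e ^ 'm \<Rightarrow> 'x"
    and \<Omega> :: "'w measure" +
  fixes n :: "nat \<Rightarrow> nat"
    and P :: "nat \<Rightarrow> nat \<Rightarrow> 'n \<Rightarrow> 'w \<Rightarrow> bool"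
    and x :: "nat \<Rightarrow> 'w \<Rightarrow> 'n \<Rightarrow> 'x"
  assumes n_pos: "0 < n k"
    and samples: "sfw_samples \<Omega> n P"
    and iterates: "sfw_iterates X E f g S \<Omega> n P x"
begin

definition block :: "nat \<Rightarrow> (nat \<times> nat \<times> 'n) set" where
  "block k = {k} \<times> {1..n k} \<times> UNIV"

definition bit :: "'w \<Rightarrow> nat \<times> nat \<times> 'n \<Rightarrow> bool" where
  "bit w = (\<lambda>(k, j, i). P k j i w)"

abbreviation (input) rate :: "nat \<times> nat \<times> 'n \<Rightarrow> real" where
  "rate a \<equiv> step_size (fst a)"

abbreviation candidate :: "('n \<Rightarrow> 'x) \<Rightarrow> ('n \<Rightarrow> bool) \<Rightarrow> 'n \<Rightarrow> 'x" where
  "candidate \<equiv> sfw_candidate E f g S"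

definition agrees :: "nat \<Rightarrow> (nat \<times> nat \<times> 'n \<Rightarrow> bool) \<Rightarrow> 'w \<Rightarrow> bool" where
  "agrees k h w \<longleftrightarrow> w \<in> space \<Omega> \<and> (\<forall>a\<in>past block k. h a = bit w a)"

text \<open>
  The \<open>k\<close>-th iterate as a function of the history. Histories that do not occur get an arbitrary
  feasible value.
\<close>

definition iterate :: "nat \<Rightarrow> (nat \<times> nat \<times> 'n \<Rightarrow> bool) \<Rightarrow> 'n \<Rightarrow> 'x" where
  "iterate k h =
    x k (if \<exists>w. agrees k h w then SOME w. agrees k h w else SOME w. w \<in> space \<Omega>)"

lemma
  shows initial_point: "\<exists>x0\<in>dec_space X. \<forall>w\<in>space \<Omega>. x 0 w = x0"
    and next_is_arg_min: "w \<in> space \<Omega> \<Longrightarrow> is_arg_min (cost f g)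
      (\<lambda>z. z \<in> {candidate (x k w) (\<lambda>i. P k j i w) | j. j \<in> {1..n k}}) (x (Suc k) w)"
    and determined_by_past: "\<lbrakk>w \<in> space \<Omega>; w' \<in> space \<Omega>;
      \<forall>k'<k. \<forall>j\<in>{1..n k'}. \<forall>i. P k' j i w = P k' j i w'\<rbrakk> \<Longrightarrow> x k w = x k w'"
  by (fact conjunct1[OF iterates[unfolded sfw_iterates_def]],
      erule conjunct1[OF conjunct2[OF iterates[unfolded sfw_iterates_def]], THEN spec, THEN bspec],
      rule conjunct2[OF conjunct2[OF iterates[unfolded sfw_iterates_def]], THEN spec, THEN bspec, THEN bspec, THEN mp])

lemma x_in_dec_space: "w \<in> space \<Omega> \<Longrightarrow> x k w \<in> dec_space X"
proof (induction k)
  case 0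
  then show ?case using initial_point by fastforce
next
  case (Suc k)
  have "x (Suc k) w \<in> {candidate (x k w) (\<lambda>i. P k j i w) | j. j \<in> {1..n k}}"
    using next_is_arg_min[OF Suc.prems] unfolding is_arg_min_def by blast
  then show ?case using candidate_in_dec_space[OF Suc.IH[OF Suc.prems]] by auto
qed

text \<open>Feasibility is needed for impossible histories too, because \<open>adaptive_bits\<close>
  demands the difference bounds for every \<open>h\<close>.\<close>

lemma iterate_in_dec_space: "iterate k h \<in> dec_space X"
proof -
  have "(SOME w. w \<in> space \<Omega>) \<in> space \<Omega>" using not_empty by (simp add: some_in_eq)
  moreover have "(SOME w. agrees k h w) \<in> space \<Omega>" if "\<exists>w. agrees k h w"
    using someI_ex[OF that] unfolding agrees_def by (rule conjunct1)
  ultimately show ?thesis by (auto simp: iterate_def intro!: x_in_dec_space)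
qed

text \<open>The choice in \<open>iterate\<close> is harmless: outcomes that agree with the same
  history have the same k-th iterate, by the requirement on tie-breaking.\<close>

lemma iterate_eq:
  assumes "agrees k h w"
  shows "iterate k h = x k w"
proof -
  define w' where "w' = (SOME w. agrees k h w)"
  have w': "agrees k h w'" unfolding w'_def by (rule someI[of "agrees k h", OF assms])
  have sp: "w' \<in> space \<Omega>" "w \<in> space \<Omega>" using w' assms unfolding agrees_def by blast+
  have same: "bit w' a = bit w a" if "a \<in> past block k" for a
  proof -
    have "h a = bit w' a" "h a = bit w a" using w' assms that unfolding agrees_def by blast+
    then show ?thesis by simp
  qed
  have "x k w' = x k w"
  proof (rule determined_by_past[OF sp], intro allI ballI impI)
    fix k' j i assume "k' < k" "j \<in> {1..n k'}"
    then have "(k', j, i) \<in> past block k" by (auto simp: past_def block_def)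
    from same[OF this] show "P k' j i w' = P k' j i w" by (simp add: bit_def)
  qed
  moreover have "\<exists>w. agrees k h w" using assms by blast
  ultimately show ?thesis by (simp add: iterate_def w'_def[symmetric])
qed

lemma iterate_restr: "w \<in> space \<Omega> \<Longrightarrow> iterate k (restr (past block k) (bit w)) = x k w"
  by (intro iterate_eq) (simp add: agrees_def restr_def)

definition sample_mean :: "nat \<Rightarrow> ('n \<Rightarrow> 'x) \<Rightarrow> (nat \<times> nat \<times> 'n \<Rightarrow> bool) \<Rightarrow> real" where
  "sample_mean k z b = (\<Sum>j\<in>{1..n k}. cost f g (candidate z (\<lambda>i. b (k, j, i)))) / real (n k)"

text \<open>Chosen so that \<open>weight k * (1 - step_size k)\<close> is k(k+1), the weight of the
  preceding iteration; the recursion then telescopes.\<close>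

definition weight :: "nat \<Rightarrow> real" where
  "weight k = (real k + 1) * (real k + 2)"

text \<open>The expectation is over block \<open>k\<close> alone with the iterate frozen by
  \<open>h\<close>, which makes the noise centred for each history separately.\<close>

definition noise ::
    "nat \<Rightarrow> (nat \<times> nat \<times> 'n \<Rightarrow> bool) \<Rightarrow> (nat \<times> nat \<times> 'n \<Rightarrow> bool) \<Rightarrow> real" where
  "noise k h b = weight k * (sample_mean k (iterate k h) b
    - measure_pmf.expectation (bits (block k) rate) (sample_mean k (iterate k h)))"

definition noise_diff :: "nat \<times> nat \<times> 'n \<Rightarrow> real" where
  "noise_diff a = weight (fst a) * (C0 X g L / real CARD('n)) / real (n (fst a))"

lemma rate_bounds: "0 \<le> step_size k" "step_size k \<le> 1"
  by (auto simp: step_size_def field_simps)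

lemma weight_pos: "0 < weight k"
  by (simp add: weight_def)

sublocale adaptive_bits block rate noise_diff noise
proof
  fix k l :: nat and a :: "nat \<times> nat \<times> 'n" and b b' h
  show fin: "finite (block k)" by (simp add: block_def)
  show "block k \<inter> block l = {}" if "k \<noteq> l" using that by (auto simp: block_def)
  show "0 \<le> rate a \<and> rate a \<le> 1" by (simp add: rate_bounds)
  show "noise k h b = noise k h b'" if "\<And>a. a \<in> block k \<Longrightarrow> b a = b' a"
    using that by (simp add: noise_def sample_mean_def block_def)
  show "measure_pmf.expectation (bits (block k) rate) (noise k h) = 0"
    by (simp add: noise_def[abs_def] integrable_bits fin)
  show "\<bar>noise k h (b(a := True)) - noise k h (b(a := False))\<bar> \<le> noise_diff a" if a: "a \<in> block k"
  proof -
    obtain j i where a_eq: "a = (k, j, i)" and j: "j \<in> {1..n k}" using a by (auto simp: block_def)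
    define z where "z = iterate k h"
    define D where "D l = cost f g (candidate z (\<lambda>i. (b(a := True)) (k, l, i)))
      - cost f g (candidate z (\<lambda>i. (b(a := False)) (k, l, i)))" for l
    \<comment> \<open>The flipped bit belongs to sample \<open>j\<close> only, so one of the
      \<open>n k\<close> summands changes.\<close>
    have "D l = 0" if "l \<noteq> j" for l using that by (simp add: D_def a_eq)
    then have sum: "(\<Sum>l\<in>{1..n k}. D l) = D j"
      using j by (subst sum.remove[of _ j]) auto
    have "(\<lambda>i'. (b(a := v)) (k, j, i')) = (\<lambda>i'. b (k, j, i'))(i := v)" for v
      by (auto simp: a_eq)
    then have D: "\<bar>D j\<bar> \<le> C0 X g L / real CARD('n)"
      unfolding D_def by (simp only: candidate_difference[OF iterate_in_dec_space] z_def)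
    have "noise k h (b(a := True)) - noise k h (b(a := False)) = weight k * (D j / real (n k))"
    proof -
      have "u * (A / m - e) - u * (B / m - e) = u * ((A - B) / m)" for u A m e B :: real
        by (simp add: diff_divide_distrib algebra_simps)
      then show ?thesis
        unfolding sum[symmetric]
        unfolding D_def noise_def sample_mean_def z_def by (simp only: sum_subtractf)
    qed
    then have "\<bar>noise k h (b(a := True)) - noise k h (b(a := False))\<bar> = weight k * (\<bar>D j\<bar> / real (n k))"
      using weight_pos[of k] by (simp only: abs_mult) simp
    also have "\<dots> \<le> weight k * (C0 X g L / real CARD('n) / real (n k))"
      using weight_pos[of k] by (intro mult_left_mono divide_right_mono D) auto
    finally show ?thesis by (simp add: noise_diff_def a_eq)
  qed
qed

text \<open>Each of the N * n_k bits has variance \<open>step_size k * (1 - step_size k)\<close>,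
  that is 2k/(k+2)^2; the denominator cancels against the squared weight. The value at
  \<open>k = 0\<close> is 0.\<close>

lemma block_var_eq:
  "block_var k = 2 * real k * (real k + 1)\<^sup>2 * (C0 X g L)\<^sup>2 / (real CARD('n) * real (n k))"
proof -
  define c where "c = C0 X g L"
  define N where "N = real CARD('n)"
  have N: "0 < N" by (simp add: N_def)
  have "block_var k = (\<Sum>a\<in>block k. step_size k * (1 - step_size k) * (weight k * (c / N) / real (n k))\<^sup>2)"
    unfolding block_var_def by (intro sum.cong) (auto simp: block_def noise_diff_def c_def N_def)
  also have "\<dots> = (real (n k) * N) * (step_size k * (1 - step_size k) * (weight k * (c / N) / real (n k))\<^sup>2)"
    by (simp add: block_def N_def)
  also have "step_size k * (1 - step_size k) = 2 * real k / (real k + 2)\<^sup>2"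
    by (simp add: step_size_def field_simps power2_eq_square)
  also have "(real (n k) * N) * (2 * real k / (real k + 2)\<^sup>2 * (weight k * (c / N) / real (n k))\<^sup>2)
    = 2 * real k * (real k + 1)\<^sup>2 * c\<^sup>2 / (N * real (n k))"
  proof -
    have "(m * N) * (2 * a / u\<^sup>2 * (v * u * (c / N) / m)\<^sup>2) = 2 * a * v\<^sup>2 * c\<^sup>2 / (N * m)"
      if "0 < u" "0 < m" for u v a m :: real
      using N that by (simp add: field_simps power2_eq_square)
    then show ?thesis using n_pos[of k] by (simp add: weight_def)
  qed
  finally show ?thesis by (simp add: c_def N_def)
qed

subsection \<open>The recursion for the gap\<close>

lemma expected_sample_mean:
  assumes z: "z \<in> dec_space X"
  shows "measure_pmf.expectation (bits (block k) rate) (sample_mean k z)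
    \<le> cost f g z - step_size k * gap X f g z
      + C1 X g L' / 2 * ((step_size k)\<^sup>2 + step_size k * (1 - step_size k) / real CARD('n))"
    (is "_ \<le> ?rhs")
proof -
  have le: "measure_pmf.expectation (bits (block k) rate) (\<lambda>b. cost f g (candidate z (\<lambda>i. b (k, j, i)))) \<le> ?rhs"
    if j: "j \<in> {1..n k}" for j
  proof -
    have "measure_pmf.expectation (bits (block k) rate) (\<lambda>b. cost f g (candidate z (\<lambda>i. b (k, j, i))))
      \<le> cost f g z + step_size k * (price z \<bullet> (agg g (best z) - agg g z))
        + C1 X g L' / 2 * ((step_size k)\<^sup>2 + step_size k * (1 - step_size k) / real CARD('n))"
      using j by (intro expected_candidate[where h = "\<lambda>i. (k, j, i)"] finite_block z)
        (auto simp: rate_bounds block_def inj_def)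
    moreover have "step_size k * gap X f g z \<le> step_size k * (price z \<bullet> (agg g z - agg g (best z)))"
      by (intro mult_left_mono gap_bounds z rate_bounds)
    ultimately show ?thesis by (simp add: inner_diff_right algebra_simps)
  qed
  have "measure_pmf.expectation (bits (block k) rate) (sample_mean k z)
    = (\<Sum>j\<in>{1..n k}. measure_pmf.expectation (bits (block k) rate)
        (\<lambda>b. cost f g (candidate z (\<lambda>i. b (k, j, i))))) / real (n k)"
    unfolding sample_mean_def[abs_def] by (simp add: integrable_bits finite_block)
  also have "\<dots> \<le> (\<Sum>j\<in>{1..n k}. ?rhs) / real (n k)"
    by (intro divide_right_mono sum_mono le) auto
  also have "\<dots> = ?rhs" using n_pos[of k] by simp
  finally show ?thesis .
qed

lemma gap_step:
  assumes w: "w \<in> space \<Omega>" and k: "k < 2 * CARD('n)" and C1: "0 \<le> C1 X g L'"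
  shows "weight k * gap X f g (x (Suc k) w)
    \<le> real k * (real k + 1) * gap X f g (x k w) + 4 * C1 X g L'
      + noise k (restr (past block k) (bit w)) (bit w)"
proof -
  let ?z = "x k w" and ?\<omega> = "step_size k" and ?m = "sample_mean k (x k w) (bit w)"
  have z: "?z \<in> dec_space X" by (rule x_in_dec_space[OF w])
  have "cost f g (x (Suc k) w) \<le> cost f g (candidate ?z (\<lambda>i. bit w (k, j, i)))" if "j \<in> {1..n k}" for j
  proof -
    have "is_arg_min (cost f g) (\<lambda>z. z \<in> {candidate ?z (\<lambda>i. P k j i w) | j. j \<in> {1..n k}}) (x (Suc k) w)"
      by (rule next_is_arg_min[OF w])
    then have "\<not> cost f g (candidate ?z (\<lambda>i. P k j i w)) < cost f g (x (Suc k) w)"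
      using that unfolding is_arg_min_def by blast
    then show ?thesis by (simp add: bit_def)
  qed
  then have "(\<Sum>j\<in>{1..n k}. cost f g (x (Suc k) w)) / real (n k) \<le> ?m"
    unfolding sample_mean_def by (intro divide_right_mono sum_mono) auto
  then have "cost f g (x (Suc k) w) \<le> ?m" using n_pos[of k] by simp
  then have "gap X f g (x (Suc k) w) \<le> (1 - ?\<omega>) * gap X f g ?z
      + C1 X g L' / 2 * (?\<omega>\<^sup>2 + ?\<omega> * (1 - ?\<omega>) / real CARD('n))
      + (?m - measure_pmf.expectation (bits (block k) rate) (sample_mean k ?z))"
    using expected_sample_mean[OF z, of k] by (simp add: gap_def algebra_simps)
  then have "weight k * gap X f g (x (Suc k) w) \<le> weight k * ((1 - ?\<omega>) * gap X f g ?z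
      + C1 X g L' / 2 * (?\<omega>\<^sup>2 + ?\<omega> * (1 - ?\<omega>) / real CARD('n))
      + (?m - measure_pmf.expectation (bits (block k) rate) (sample_mean k ?z)))"
    using weight_pos[of k] by (intro mult_left_mono) auto
  also have "\<dots> = weight k * (1 - ?\<omega>) * gap X f g ?z
      + C1 X g L' * (weight k / 2 * (?\<omega>\<^sup>2 + ?\<omega> * (1 - ?\<omega>) / real CARD('n)))
      + noise k (restr (past block k) (bit w)) (bit w)"
  proof -
    have "u * ((1 - o') * G + c / 2 * q + d) = u * (1 - o') * G + c * (u / 2 * q) + u * d"
      for u o' G c q d :: real
      by (simp add: algebra_simps)
    then show ?thesis unfolding noise_def iterate_restr[OF w] .
  qed
  also have "weight k * (1 - ?\<omega>) = real k * (real k + 1)"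
    by (simp add: weight_def step_size_def field_simps)
  \<comment> \<open>Here \<open>k < 2 * CARD('n)\<close> enters: the error factor is (k+1)/(k+2) *
    (2 + k/N), and k/N is at most 2, whence the constant 4.\<close>
  also have "C1 X g L' * (weight k / 2 * (?\<omega>\<^sup>2 + ?\<omega> * (1 - ?\<omega>) / real CARD('n))) \<le> C1 X g L' * 4"
  proof (rule mult_left_mono[OF _ C1])
    have "weight k / 2 * (?\<omega>\<^sup>2 + ?\<omega> * (1 - ?\<omega>) / real CARD('n))
      = (real k + 1) / (real k + 2) * (2 + real k / real CARD('n))"
      by (simp add: weight_def step_size_def divide_simps power2_eq_square)
    also have "\<dots> \<le> 1 * (2 + 2)"
      using k by (intro mult_mono add_mono) (auto simp: pos_divide_le_eq)
    finally show "weight k / 2 * (?\<omega>\<^sup>2 + ?\<omega> * (1 - ?\<omega>) / real CARD('n)) \<le> 4" by simp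
  qed
  finally show ?thesis by simp
qed

text \<open>The recursion starts with factor k(k+1) = 0, so the initial gap leaves no trace.\<close>

lemma gap_le_martingale:
  assumes w: "w \<in> space \<Omega>" and C1: "0 \<le> C1 X g L'"
  shows "K \<le> 2 * CARD('n) \<Longrightarrow>
    real K * (real K + 1) * gap X f g (x K w) \<le> 4 * C1 X g L' * real K + M K (bit w)"
proof (induction K)
  case (Suc K)
  have "real (Suc K) * (real (Suc K) + 1) * gap X f g (x (Suc K) w) = weight K * gap X f g (x (Suc K) w)"
    by (simp add: weight_def algebra_simps)
  also have "\<dots> \<le> real K * (real K + 1) * gap X f g (x K w) + 4 * C1 X g L'
      + noise K (restr (past block K) (bit w)) (bit w)"
    using Suc.prems by (intro gap_step w C1) simp
  also have "\<dots> \<le> 4 * C1 X g L' * real (Suc K) + M (Suc K) (bit w)"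
    using Suc by (simp add: M_def algebra_simps)
  finally show ?case .
qed (simp add: M_def)

subsection \<open>Moments and tails\<close>

text \<open>The point where independence and the Bernoulli laws enter; from here on, expectations
  and probabilities are computed under \<open>bits (past block K) rate\<close>.\<close>

lemma history_bits:
  "(\<lambda>w. restr (past block K) (bit w)) \<in> measurable \<Omega> (count_space UNIV)"
  "distr \<Omega> (count_space UNIV) (\<lambda>w. restr (past block K) (bit w)) = measure_pmf (bits (past block K) rate)"
proof -
  have eq: "(\<lambda>w. restr (past block K) (bit w)) = (\<lambda>w a. a \<in> past block K \<and> (case a of (k, j, i) \<Rightarrow> P k j i) w)"
    by (simp add: restr_def bit_def case_prod_beta fun_eq_iff)
  have ind: "indep_vars (\<lambda>_. count_space UNIV) (\<lambda>(k, j, i). P k j i) {(k, j, i). j \<in> {1..n k}}"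
    using samples by (simp add: sfw_samples_def)
  have sub: "past block K \<subseteq> {(k, j, i). j \<in> {1..n k}}" by (auto simp: past_def block_def)
  have "distr \<Omega> (count_space UNIV) (case a of (k, j, i) \<Rightarrow> P k j i) = measure_pmf (bernoulli_pmf (rate a))"
    if "a \<in> past block K" for a
    using samples that sub by (auto simp: sfw_samples_def)
  note * = distr_eq_bits[OF ind sub finite_past this]
  show "(\<lambda>w. restr (past block K) (bit w)) \<in> measurable \<Omega> (count_space UNIV)"
    "distr \<Omega> (count_space UNIV) (\<lambda>w. restr (past block K) (bit w)) = measure_pmf (bits (past block K) rate)"
    unfolding eq using * by simp_all
qed

lemma expectation_history:
  fixes H :: "_ \<Rightarrow> real"
  shows "integrable \<Omega> (\<lambda>w. H (restr (past block K) (bit w)))"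
    and "expectation (\<lambda>w. H (restr (past block K) (bit w)))
      = measure_pmf.expectation (bits (past block K) rate) H"
proof -
  have "integrable (distr \<Omega> (count_space UNIV) (\<lambda>w. restr (past block K) (bit w))) H"
    unfolding history_bits by (intro integrable_bits finite_past)
  then show "integrable \<Omega> (\<lambda>w. H (restr (past block K) (bit w)))"
    by (rule integrable_distr[OF history_bits(1)])
  show "expectation (\<lambda>w. H (restr (past block K) (bit w)))
      = measure_pmf.expectation (bits (past block K) rate) H"
    unfolding history_bits(2)[symmetric] by (rule integral_distr[symmetric, OF history_bits(1)]) simp
qed

lemma prob_history:
  "{w \<in> space \<Omega>. Q (restr (past block K) (bit w))} \<in> events"
  "prob {w \<in> space \<Omega>. Q (restr (past block K) (bit w))} = measure_pmf.prob (bits (past block K) rate) {b. Q b}"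
proof -
  have eq: "{w \<in> space \<Omega>. Q (restr (past block K) (bit w))}
    = (\<lambda>w. restr (past block K) (bit w)) -` {b. Q b} \<inter> space \<Omega>" by auto
  show "{w \<in> space \<Omega>. Q (restr (past block K) (bit w))} \<in> events"
    unfolding eq by (rule measurable_sets[OF history_bits(1)]) simp
  show "prob {w \<in> space \<Omega>. Q (restr (past block K) (bit w))} = measure_pmf.prob (bits (past block K) rate) {b. Q b}"
    unfolding eq history_bits(2)[symmetric] by (rule measure_distr[symmetric, OF history_bits(1)]) simp
qed

text \<open>The gap factors through the finitely many bits of the past, so \<phi> and
  \<open>Q\<close> may be arbitrary, without measurability conditions.\<close>

lemma
  shows integrable_gap: "integrable \<Omega> (\<lambda>w. \<phi> (gap X f g (x K w)) :: real)"
    and gap_events: "{w \<in> space \<Omega>. Q (gap X f g (x K w))} \<in> events"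
proof -
  have "integrable \<Omega> (\<lambda>w. \<phi> (gap X f g (iterate K (restr (past block K) (bit w)))) :: real)"
    by (rule expectation_history)
  then show "integrable \<Omega> (\<lambda>w. \<phi> (gap X f g (x K w)))"
    by (rule Bochner_Integration.integrable_cong[THEN iffD1, OF refl, rotated]) (simp add: iterate_restr)
  have "{w \<in> space \<Omega>. Q (gap X f g (iterate K (restr (past block K) (bit w))))} \<in> events"
    by (rule prob_history)
  also have "{w \<in> space \<Omega>. Q (gap X f g (iterate K (restr (past block K) (bit w))))}
    = {w \<in> space \<Omega>. Q (gap X f g (x K w))}"
    by (auto simp: iterate_restr)
  finally show "{w \<in> space \<Omega>. Q (gap X f g (x K w))} \<in> events" .
qed

lemma expectation_mono:
  fixes \<phi> :: "real \<Rightarrow> real" and H :: "_ \<Rightarrow> real"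
  assumes "\<And>w. w \<in> space \<Omega> \<Longrightarrow> \<phi> (gap X f g (x K w)) \<le> H (restr (past block K) (bit w))"
  shows "expectation (\<lambda>w. \<phi> (gap X f g (x K w))) \<le> measure_pmf.expectation (bits (past block K) rate) H"
  unfolding expectation_history(2)[symmetric]
  using assms by (intro integral_mono integrable_gap expectation_history)

lemma v_bound_eq:
  assumes "1 \<le> K"
  shows "(\<Sum>l<K. block_var l) = (real K * (real K + 1))\<^sup>2 * (v_bound (C0 X g L) n K / real CARD('n))"
proof -
  \<comment> \<open>The term at 0 vanishes, which is why the sum in \<open>v_bound\<close> can start
    at 1.\<close>
  have "(\<Sum>l<K. block_var l) = (\<Sum>l\<in>{1..K-1}. block_var l)"
    using assms by (intro sum.mono_neutral_right) (auto simp: block_var_eq)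
  also have "\<dots> = 2 * (C0 X g L)\<^sup>2 / real CARD('n) * (\<Sum>k\<in>{1..K-1}. real k * (real k + 1)\<^sup>2 / real (n k))"
    by (simp add: block_var_eq sum_distrib_left mult_ac)
  also have "\<dots> = (real K * (real K + 1))\<^sup>2 * (v_bound (C0 X g L) n K / real CARD('n))"
    using assms by (simp add: v_bound_def power_mult_distrib)
  finally show ?thesis .
qed

context
  fixes K :: nat
  assumes K: "1 \<le> K" "K \<le> 2 * CARD('n)"
    and C0: "0 < C0 X g L" and C1: "0 < C1 X g L'"
begin

abbreviation (input) scale :: real where "scale \<equiv> real K * (real K + 1)"

lemma scale_pos: "0 < scale"
  using K by simp

text \<open>Dividing \<open>gap_le_martingale\<close> by K(K+1) would give 4 C1/(K+1); this is
  relaxed to 4 C1/K.\<close>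

lemma gap_le:
  assumes "w \<in> space \<Omega>"
  shows "gap X f g (x K w) - 4 * C1 X g L' / real K \<le> M K (restr (past block K) (bit w)) / scale"
proof -
  have "scale * (gap X f g (x K w) - 4 * C1 X g L' / real K)
    = scale * gap X f g (x K w) - 4 * C1 X g L' * (real K + 1)"
    using K by (simp add: field_simps)
  also have "\<dots> \<le> M K (bit w)"
    using gap_le_martingale[OF assms, of K] K C1 by (simp add: algebra_simps)
  finally show ?thesis
    using scale_pos by (simp add: M_restr pos_le_divide_eq mult.commute)
qed

lemma expectation_gap: "expectation (\<lambda>w. gap X f g (x K w)) \<le> 4 * C1 X g L' / real K"
proof -
  have "expectation (\<lambda>w. gap X f g (x K w))
    \<le> measure_pmf.expectation (bits (past block K) rate) (\<lambda>b. 4 * C1 X g L' / real K + M K b / scale)"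
    using gap_le by (intro expectation_mono[of "\<lambda>r. r"]) (simp add: algebra_simps)
  also have "\<dots> = 4 * C1 X g L' / real K"
    by (simp add: integrable_bits finite_past expectation_M)
  finally show ?thesis .
qed

text \<open>\<open>gap_le\<close> is one-sided, so only the positive part of the excess is dominated
  in absolute value by the scaled martingale, whose second moment is known.\<close>

lemma expectation_excess:
  "expectation (\<lambda>w. (max (gap X f g (x K w) - 4 * C1 X g L' / real K) 0)\<^sup>2)
    \<le> v_bound (C0 X g L) n K / real CARD('n)"
proof -
  have "expectation (\<lambda>w. (max (gap X f g (x K w) - 4 * C1 X g L' / real K) 0)\<^sup>2)
    \<le> measure_pmf.expectation (bits (past block K) rate) (\<lambda>b. (M K b / scale)\<^sup>2)"
  proof (rule expectation_mono[of "\<lambda>r. (max (r - 4 * C1 X g L' / real K) 0)\<^sup>2"])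
    fix w assume "w \<in> space \<Omega>"
    from gap_le[OF this] have "\<bar>max (gap X f g (x K w) - 4 * C1 X g L' / real K) 0\<bar>
      \<le> \<bar>M K (restr (past block K) (bit w)) / scale\<bar>" by linarith
    then show "(max (gap X f g (x K w) - 4 * C1 X g L' / real K) 0)\<^sup>2
      \<le> (M K (restr (past block K) (bit w)) / scale)\<^sup>2" by (simp only: abs_le_square_iff)
  qed
  also have "\<dots> = measure_pmf.expectation (bits (past block K) rate) (\<lambda>b. (M K b)\<^sup>2) / scale\<^sup>2"
    by (simp add: power_divide)
  also have "\<dots> \<le> (\<Sum>l<K. block_var l) / scale\<^sup>2"
    by (intro divide_right_mono second_moment_M) simp
  also have "\<dots> = v_bound (C0 X g L) n K / real CARD('n)"
    using scale_pos K by (simp add: v_bound_eq)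
  finally show ?thesis .
qed

text \<open>The variance is at most the second moment about c = 4 C1/K. Above c this is the squared
  excess; below c the deviation is at most c, because the gap is nonnegative.\<close>

lemma variance_gap:
  "variance (\<lambda>w. gap X f g (x K w))
    \<le> 16 * (C1 X g L')\<^sup>2 / (real K)\<^sup>2 + v_bound (C0 X g L) n K / real CARD('n)"
proof -
  define c where "c = 4 * C1 X g L' / real K"
  define \<gamma> where "\<gamma> w = gap X f g (x K w)" for w
  define e where "e = expectation \<gamma>"
  have int: "integrable \<Omega> (\<lambda>w. \<phi> (\<gamma> w) :: real)" for \<phi> unfolding \<gamma>_def by (rule integrable_gap)
  have "variance \<gamma> \<le> variance \<gamma> + (e - c)\<^sup>2" by simp
  also have "\<dots> = expectation (\<lambda>w. (\<gamma> w)\<^sup>2) - e\<^sup>2 + (e - c)\<^sup>2"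
    using variance_eq[OF int[of "\<lambda>r. r"] int[of "\<lambda>r. r\<^sup>2"]] by (simp add: e_def)
  also have "\<dots> = expectation (\<lambda>w. (\<gamma> w)\<^sup>2 - 2 * c * \<gamma> w + c\<^sup>2)"
    using int[of "\<lambda>r. r"] int[of "\<lambda>r. r\<^sup>2"]
    by (simp add: e_def prob_space power2_eq_square algebra_simps)
  also have "\<dots> \<le> expectation (\<lambda>w. (max (\<gamma> w - c) 0)\<^sup>2 + c\<^sup>2)"
  proof (rule integral_mono)
    show "integrable \<Omega> (\<lambda>w. (\<gamma> w)\<^sup>2 - 2 * c * \<gamma> w + c\<^sup>2)"
      by (rule int[of "\<lambda>r. r\<^sup>2 - 2 * c * r + c\<^sup>2"])
    show "integrable \<Omega> (\<lambda>w. (max (\<gamma> w - c) 0)\<^sup>2 + c\<^sup>2)"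
      by (rule int[of "\<lambda>r. (max (r - c) 0)\<^sup>2 + c\<^sup>2"])
    fix w assume "w \<in> space \<Omega>"
    then have \<gamma>: "0 \<le> \<gamma> w" unfolding \<gamma>_def by (intro gap_bounds x_in_dec_space)
    have c: "0 \<le> c" using C1 K by (simp add: c_def)
    show "(\<gamma> w)\<^sup>2 - 2 * c * \<gamma> w + c\<^sup>2 \<le> (max (\<gamma> w - c) 0)\<^sup>2 + c\<^sup>2"
    proof (cases "c \<le> \<gamma> w")
      case False
      then have "\<gamma> w * \<gamma> w \<le> (2 * c) * \<gamma> w" using \<gamma> c by (intro mult_right_mono) auto
      then show ?thesis using False by (simp add: power2_eq_square)
    qed (simp add: power2_eq_square algebra_simps)
  qed
  also have "\<dots> = expectation (\<lambda>w. (max (\<gamma> w - c) 0)\<^sup>2) + c\<^sup>2"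
    using int[of "\<lambda>r. (max (r - c) 0)\<^sup>2"] by (simp add: prob_space)
  also have "\<dots> \<le> v_bound (C0 X g L) n K / real CARD('n) + c\<^sup>2"
    unfolding \<gamma>_def c_def by (intro add_right_mono expectation_excess)
  also have "c\<^sup>2 = 16 * (C1 X g L')\<^sup>2 / (real K)\<^sup>2"
    by (simp add: c_def power_divide power_mult_distrib)
  finally show ?thesis by (simp add: \<gamma>_def)
qed

lemma prob_excess_le:
  assumes \<epsilon>: "0 < \<epsilon>"
  shows "prob {w \<in> space \<Omega>. 4 * C1 X g L' / real K + \<epsilon> \<le> gap X f g (x K w)}
    \<le> exp_term (C0 X g L) n K (real CARD('n)) \<epsilon>"
proof (cases "K = 1")
  \<comment> \<open>For \<open>K = 1\<close> the variance proxy is 0, while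
    \<open>Freedman_M\<close> requires a positive one. Instead the excess has second moment 0, and a
    Chebyshev bound makes the bad event null, as the convention for \<open>exp_term\<close>
    demands.\<close>
  case True
  define c where "c = 4 * C1 X g L' / real K"
  have "\<epsilon>\<^sup>2 * prob {w \<in> space \<Omega>. c + \<epsilon> \<le> gap X f g (x K w)}
    = expectation (\<lambda>w. \<epsilon>\<^sup>2 * indicator {w \<in> space \<Omega>. c + \<epsilon> \<le> gap X f g (x K w)} w)"
    using gap_events by simp
  also have "\<dots> \<le> expectation (\<lambda>w. (max (gap X f g (x K w) - c) 0)\<^sup>2)"
  proof (rule integral_mono)
    show "integrable \<Omega> (\<lambda>w. \<epsilon>\<^sup>2 * indicator {w \<in> space \<Omega>. c + \<epsilon> \<le> gap X f g (x K w)} w)"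
      using gap_events by (simp add: emeasure_eq_measure)
    show "integrable \<Omega> (\<lambda>w. (max (gap X f g (x K w) - c) 0)\<^sup>2)"
      by (rule integrable_gap)
    show "\<epsilon>\<^sup>2 * indicator {w \<in> space \<Omega>. c + \<epsilon> \<le> gap X f g (x K w)} w
      \<le> (max (gap X f g (x K w) - c) 0)\<^sup>2" for w
      using \<epsilon> by (auto simp: indicator_def intro!: power_mono)
  qed
  also have "\<dots> \<le> v_bound (C0 X g L) n K / real CARD('n)"
    unfolding c_def by (rule expectation_excess)
  also have "\<dots> = 0" using True by (simp add: v_bound_def)
  finally have "prob {w \<in> space \<Omega>. c + \<epsilon> \<le> gap X f g (x K w)} \<le> 0"
    using \<epsilon> by (simp add: mult_le_0_iff)
  then show ?thesis using True by (simp add: exp_term_def c_def)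
next
  case False
  define N where "N = real CARD('n)"
  define v where "v = v_bound (C0 X g L) n K"
  define m where "m = m_bound (C0 X g L) n K"
  define S where "S = (\<lambda>k. (real k + 1) * (real k + 2) / real (n k)) ` {1..K-1}"
  have N: "0 < N" by (simp add: N_def)
  have S: "finite S" "S \<noteq> {}" using False K by (auto simp: S_def)
  have m_eq: "m = C0 X g L / scale * Max S" using False by (simp add: m_def m_bound_def S_def)
  have "0 \<le> Max S" using S by (subst Max_ge_iff) (auto simp: S_def)
  then have m: "0 \<le> m" using C0 by (simp add: m_eq)
  have v: "0 < v"
  proof -
    have "0 < (\<Sum>k\<in>{1..K-1}. real k * (real k + 1)\<^sup>2 / real (n k))"
      using False K n_pos by (intro sum_pos) auto
    then show ?thesis using C0 K by (simp add: v_def v_bound_def)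
  qed
  \<comment> \<open>A rate below 1 rules out iteration 0, so only indices occurring in the maximum
    of \<open>m_bound\<close> remain.\<close>
  have diff: "noise_diff a \<le> scale * m / N" if "l < K" "a \<in> block l" "rate a < 1" for l a
  proof -
    have fst: "fst a = l" using that by (auto simp: block_def)
    have "l \<noteq> 0" using that fst by (auto simp: step_size_def)
    then have "weight l / real (n l) \<le> Max S"
      using S that by (intro Max_ge) (auto simp: S_def weight_def intro!: imageI)
    then have "C0 X g L / N * (weight l / real (n l)) \<le> C0 X g L / N * Max S"
      using C0 N by (intro mult_left_mono) auto
    then show ?thesis using scale_pos K by (simp add: noise_diff_def fst m_eq N_def mult_ac)
  qed
  have "prob {w \<in> space \<Omega>. 4 * C1 X g L' / real K + \<epsilon> \<le> gap X f g (x K w)}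
    \<le> prob {w \<in> space \<Omega>. scale * \<epsilon> \<le> M K (restr (past block K) (bit w))}"
  proof (rule finite_measure_mono)
    show "{w \<in> space \<Omega>. 4 * C1 X g L' / real K + \<epsilon> \<le> gap X f g (x K w)}
      \<subseteq> {w \<in> space \<Omega>. scale * \<epsilon> \<le> M K (restr (past block K) (bit w))}"
    proof safe
      fix w assume "w \<in> space \<Omega>" "4 * C1 X g L' / real K + \<epsilon> \<le> gap X f g (x K w)"
      with gap_le[of w] have "\<epsilon> \<le> M K (restr (past block K) (bit w)) / scale" by linarith
      then show "scale * \<epsilon> \<le> M K (restr (past block K) (bit w))"
        using scale_pos by (simp add: pos_le_divide_eq mult.commute)
    qed
  qed (rule prob_history)
  also have "\<dots> = measure_pmf.prob (bits (past block K) rate) {b. scale * \<epsilon> \<le> M K b}"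
    by (rule prob_history)
  \<comment> \<open>\<open>Freedman_M\<close> is applied to the unscaled martingale: threshold,
    variance proxy and difference bound are \<open>scale * \<epsilon>\<close>,
    \<open>scale\<^sup>2 * (v / N)\<close> and \<open>scale * m / N\<close>, and the scale then
    cancels from the exponent.\<close>
  also have "\<dots> \<le> exp (- (scale * \<epsilon>)\<^sup>2 / (2 * (scale\<^sup>2 * (v / N) + scale * m / N * (scale * \<epsilon>) / 3)))"
    using \<epsilon> scale_pos m N v K
    by (intro Freedman_M diff) (auto simp: v_bound_eq v_def N_def)
  also have "- (scale * \<epsilon>)\<^sup>2 / (2 * (scale\<^sup>2 * (v / N) + scale * m / N * (scale * \<epsilon>) / 3))
    = - (\<epsilon>\<^sup>2 * N) / (2 * (v + \<epsilon> * m / 3))"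
  proof -
    have "- (s * \<epsilon>)\<^sup>2 / (2 * (s\<^sup>2 * (v / N) + s * m / N * (s * \<epsilon>) / 3)) = - (\<epsilon>\<^sup>2 * N) / (2 * (v + \<epsilon> * m / 3))"
      if "0 < s" for s
    proof -
      have "2 * (s\<^sup>2 * (v / N) + s * m / N * (s * \<epsilon>) / 3) = s\<^sup>2 * (2 * (v + \<epsilon> * m / 3) / N)"
        by (simp add: power2_eq_square add_divide_distrib algebra_simps)
      moreover have "- (s * \<epsilon>)\<^sup>2 = s\<^sup>2 * (- \<epsilon>\<^sup>2)" by (simp add: power_mult_distrib)
      ultimately have "- (s * \<epsilon>)\<^sup>2 / (2 * (s\<^sup>2 * (v / N) + s * m / N * (s * \<epsilon>) / 3))
        = s\<^sup>2 * (- \<epsilon>\<^sup>2) / (s\<^sup>2 * (2 * (v + \<epsilon> * m / 3) / N))" by (simp only:)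
      also have "\<dots> = - \<epsilon>\<^sup>2 / (2 * (v + \<epsilon> * m / 3) / N)"
        using that by (intro mult_divide_mult_cancel_left) simp
      also have "\<dots> = - (\<epsilon>\<^sup>2 * N) / (2 * (v + \<epsilon> * m / 3))" by simp
      finally show ?thesis .
    qed
    then show ?thesis using scale_pos by blast
  qed
  finally show ?thesis using False by (simp add: exp_term_def v_def m_def N_def)
qed

lemma prob_gap_less:
  assumes "0 < \<epsilon>"
  shows "1 - exp_term (C0 X g L) n K (real CARD('n)) \<epsilon>
    \<le> prob {w \<in> space \<Omega>. gap X f g (x K w) < 4 * C1 X g L' / real K + \<epsilon>}"
proof -
  have "{w \<in> space \<Omega>. gap X f g (x K w) < 4 * C1 X g L' / real K + \<epsilon>}
    = space \<Omega> - {w \<in> space \<Omega>. 4 * C1 X g L' / real K + \<epsilon> \<le> gap X f g (x K w)}" by auto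
  then show ?thesis using prob_excess_le[OF assms] by (simp add: prob_compl gap_events)
qed

end

end

theorem theorem3p7:
  fixes X :: "'n::finite \<Rightarrow> 'x set"
    and E :: "'m::finite \<Rightarrow> 'e::{real_inner, banach, second_countable_topology} set"
    and f :: "'m \<Rightarrow> 'e \<Rightarrow> real"
    and g :: "'n \<Rightarrow> 'm \<Rightarrow> 'x \<Rightarrow> 'e"
    and L L' :: "'m \<Rightarrow> real"
    and S :: "'n \<Rightarrow> 'e ^ 'm \<Rightarrow> 'x"
    and \<Omega> :: "'w measure"
    and n :: "nat \<Rightarrow> nat"
    and P :: "nat \<Rightarrow> nat \<Rightarrow> 'n \<Rightarrow> 'w \<Rightarrow> bool"
    and x :: "nat \<Rightarrow> 'w \<Rightarrow> 'n \<Rightarrow> 'x"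
    and K :: nat
  assumes "problem_data X E g"
    and "assumption1 X E f g L L'"
    and "assumption2 X f g"
    and "assumption3 X E f g S"
    and "C0 X g L > 0"
    and "C1 X g L' > 0"
    and "prob_space \<Omega>"
    and "\<And>k. n k > 0"
    and "sfw_samples \<Omega> n P"
    and "sfw_iterates X E f g S \<Omega> n P x"
    and "1 \<le> K" and "K \<le> 2 * CARD('n)"
  shows "prob_space.expectation \<Omega> (\<lambda>w. gap X f g (x K w)) \<le> 4 * C1 X g L' / real K
    \<and> (\<forall>\<epsilon>>0. measure \<Omega> {w \<in> space \<Omega>. gap X f g (x K w) < 4 * C1 X g L' / real K + \<epsilon>}
               \<ge> 1 - exp_term (C0 X g L) n K (real CARD('n)) \<epsilon>)
    \<and> prob_space.variance \<Omega> (\<lambda>w. gap X f g (x K w))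
        \<le> 16 * (C1 X g L')\<^sup>2 / (real K)\<^sup>2 + v_bound (C0 X g L) n K / real CARD('n)
    \<and> prob_space.expectation \<Omega> (\<lambda>w. (max (gap X f g (x K w) - 4 * C1 X g L' / real K) 0)\<^sup>2)
        \<le> v_bound (C0 X g L) n K / real CARD('n)"
proof -
  interpret stochastic_frank_wolfe X E f g L L' S \<Omega> n P x
    using assms
    by (intro stochastic_frank_wolfe.intro frank_wolfe.intro stochastic_frank_wolfe_axioms.intro)
  note bounds = assms(11,12,5,6)
  show ?thesis
    using expectation_gap[OF bounds] prob_gap_less[OF bounds] variance_gap[OF bounds]
      expectation_excess[OF bounds] by blast
qed

end
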